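(* Let $T$ be a hyperbolic automorphism of $\mathbb T^2=\mathbb R^2/\mathbb Z^2$ given by $M_T\in GL(2,\mathbb Z)$ with $r=\operatorname{Tr}M_T>0$, $D=r^2-4\det M_T$, $\lambda=\frac{r+\sqrt D}2$. (I) The set of arithmetic codings $(\varphi,\mathfrak X)$ of $T$ is in a one-to-one correspondence with the points homoclinic to zero. This correspondence is given by the formula for $\varphi=\varphi_{\mathbf t}$: $$\varphi_{\mathbf t}(\varepsilon)=\lim_{N\to+\infty}\Big(\Big(\sum_{n=-N}^{N}\varepsilon_nT^{-n}\mathbf t\Big)\bmod\mathbb Z^2\Big)=\Big(\sum_{n=-\infty}^{\infty}\varepsilon_n\lambda^{-n}\Big)\mathbf t\bmod\mathbb Z^2 ,$$ where $\mathbf t$ is a homoclinic point for $T$ (in coordinates of $\mathbb R^2$). Conversely, if $\mathbf t$ is a homoclinic point for $T$, the series in this formula converges and the mapping specifies an arithmetic coding for $T$. Furthermore, if $\mathbf t\ne\mathbf 0$, then $\varphi_{\mathbf t}$ is surjective. (II) For each coding, the shift-invariant subset $\mathfrak X$ satisfying the requirements in the definition of an arithmetic coding, i.e. the surjectivity of the mapping $\varphi_{\mathbf t}|_{\mathfrak X}$ and its bijectivity on the set of finite sequences belonging to $\mathfrak X$, is the stationary Markov compactum $\mathfrak X_r$ for $\det M_T=-1$ or the sofic compactum $\mathfrak Y_r$ for $\det M_T=+1$.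
   Context: Hyperbolicity with $r>0$ means $r\ge1$ if $\det M_T=-1$ and $r\ge3$ if $\det M_T=+1$. $\widetilde{\mathfrak X}$ is the set of all two-sided sequences $\varepsilon=\{\varepsilon_n\}_{n\in\mathbb Z}$ of nonnegative integers such that the series $\sum_{n\ge1}\varepsilon_n\lambda^{-n}$ and $\sum_{n\ge1}\varepsilon_{-n}\lambda^{-n}$ converge. It is endowed with the natural (weak) topology, i.e. that of coordinate-wise convergence, and with coordinate-wise addition, under which it is a semigroup. The two-sided shift is $(\tau\varepsilon)_n=\varepsilon_{n+1}$. A sequence is finite if it has only finitely many nonzero coordinates. For one-sided sequences, $(\varepsilon_1,\varepsilon_2,\dots)\prec_{\mathrm{lex}}(\varepsilon'_1,\varepsilon'_2,\dots)$ means that $\varepsilon_n<\varepsilon'_n$ for the least $n\ge1$ with $\varepsilon_n\ne\varepsilon'_n$. A subset $\mathfrak X\subset\widetilde{\mathfrak X}$ is total if together with a sequence $\{\varepsilon_n\}$ it contains each sequence $\{\varepsilon'_n\}$ such that, for some fixed $N\in\mathbb Z$ and any $k\ge0$, $(\varepsilon'_{N+k},\varepsilon'_{N+k+1},\dots)\prec_{\mathrm{lex}}(\varepsilon_N,\varepsilon_{N+1},\dots)$. An arithmetic coding of $T$ is a pair $(\varphi,\mathfrak X)$, where $\varphi:\widetilde{\mathfrak X}\to\mathbb T^2$ is a continuous semigroup homomorphism with $\varphi\tau=T\varphi$, and $\mathfrak X$ is a closed, shift-invariant subset of $\widetilde{\mathfrak X}$ such that (1) $\mathfrak X$ is total, and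 (2) $\varphi$ restricted to $\mathfrak X$ is surjective and one-to-one on the set of finite sequences of $\widetilde{\mathfrak X}$ belonging to $\mathfrak X$. $\mathfrak X_r$ is the set of two-sided sequences with $\varepsilon_n\in\{0,\dots,r\}$ and $\varepsilon_n=r\Rightarrow\varepsilon_{n+1}=0$ for all $n$. $\mathfrak Y_r$ is the set of two-sided sequences with $\varepsilon_n\in\{0,\dots,r-1\}$ containing no block $(r-1)(r-2)^j(r-1)$, $j\ge0$. A point $x\in\mathbb T^2$ is homoclinic (to zero) if $T^nx\to0$ as $n\to\pm\infty$; it is written in coordinates of $\mathbb R^2$ as its unique lift $\mathbf t\in\mathbb R^2$ lying on the $\lambda$-eigenline of $M_T$, so that $T^n$ acts on $\mathbf t$ as multiplication by $\lambda^n$.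
   Formalization: Literally no coding exists. Mended: φ is continuous on each set of sequences dominated by a fixed one, not on all of the sequence space; "total" compares all tails (k any integer) in the non-strict lexicographic order; codings (φ,X) correspond to nonzero homoclinic points, as φ_0=0 is not onto. *)

theory Defs
  imports "HOL-Analysis.Analysis"
begin

subsection \<open>The 2-torus\<close>

definition torus_rel :: "real^2 \<Rightarrow> real^2 \<Rightarrow> bool" where
  "torus_rel x y \<longleftrightarrow> (\<forall>i. x $ i - y $ i \<in> \<int>)"

lemma equivp_torus_rel: "equivp torus_rel"
proof (rule equivpI)
  show "reflp torus_rel" by (auto simp: reflp_def torus_rel_def)
  show "symp torus_rel"
    unfolding symp_def torus_rel_def by (metis Ints_minus minus_diff_eq)
  show "transp torus_rel"
  proof (rule transpI)
    fix x y z assume "torus_rel x y" "torus_rel y z"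
    then have "(x $ i - y $ i) + (y $ i - z $ i) \<in> \<int>" for i
      unfolding torus_rel_def by (intro Ints_add) auto
    then show "torus_rel x z" by (simp add: torus_rel_def)
  qed
qed

text \<open>\<open>to_torus\<close> is reduction modulo the integer lattice.\<close>

quotient_type torus2 = "real^2" / torus_rel morphisms torus2_rep to_torus
  by (rule equivp_torus_rel)

lemma to_torus_eq_iff: "to_torus x = to_torus y \<longleftrightarrow> (\<forall>i. x $ i - y $ i \<in> \<int>)"
  by (simp add: torus2.abs_eq_iff torus_rel_def)

lemma to_torus_surj: "\<exists>v. x = to_torus v"
  by (metis Quotient3_abs_rep Quotient3_torus2)

instantiation torus2 :: ab_group_add
begin

lift_definition zero_torus2 :: torus2 is 0 .

lift_definition plus_torus2 :: "torus2 \<Rightarrow> torus2 \<Rightarrow> torus2" is "(+)"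
proof -
  fix a b c d :: "real^2"
  assume ab: "torus_rel a b" and cd: "torus_rel c d"
  have "(a + c) $ i - (b + d) $ i \<in> \<int>" for i
  proof -
    have "(a $ i - b $ i) + (c $ i - d $ i) \<in> \<int>"
      using ab cd unfolding torus_rel_def by (blast intro: Ints_add)
    then show ?thesis by (simp add: algebra_simps)
  qed
  then show "torus_rel (a + c) (b + d)" unfolding torus_rel_def by blast
qed

lift_definition minus_torus2 :: "torus2 \<Rightarrow> torus2 \<Rightarrow> torus2" is "(-)"
proof -
  fix a b c d :: "real^2"
  assume ab: "torus_rel a b" and cd: "torus_rel c d"
  have "(a - c) $ i - (b - d) $ i \<in> \<int>" for i
  proof -
    have "(a $ i - b $ i) - (c $ i - d $ i) \<in> \<int>"
      using ab cd unfolding torus_rel_def by (blast intro: Ints_diff)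
    then show ?thesis by (simp add: algebra_simps)
  qed
  then show "torus_rel (a - c) (b - d)" unfolding torus_rel_def by blast
qed

lift_definition uminus_torus2 :: "torus2 \<Rightarrow> torus2" is "uminus"
proof -
  fix a b :: "real^2" assume "torus_rel a b"
  then have "- (a $ i - b $ i) \<in> \<int>" for i unfolding torus_rel_def by (intro Ints_minus) auto
  then show "torus_rel (- a) (- b)" unfolding torus_rel_def by (simp add: algebra_simps)
qed

instance
  by standard (transfer; simp add: torus_rel_def algebra_simps)+

end

text \<open>The quotient topology.\<close>

instantiation torus2 :: topological_space
begin

definition open_torus2 :: "torus2 set \<Rightarrow> bool" where
  "open_torus2 U \<longleftrightarrow> open (to_torus -` U)"

instance
proof
  show "open (UNIV :: torus2 set)" by (simp add: open_torus2_def)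
  show "open (S \<inter> T)" if "open S" "open T" for S T :: "torus2 set"
    using that by (simp add: open_torus2_def open_Int)
  show "open (\<Union>K)" if "\<forall>S\<in>K. open S" for K :: "torus2 set set"
    using that by (auto simp: open_torus2_def vimage_Union)
qed

end

instance torus2 :: t2_space
proof
  fix x y :: torus2
  assume "x \<noteq> y"
  obtain a b where ab: "x = to_torus a" "y = to_torus b" using to_torus_surj by metis
  with \<open>x \<noteq> y\<close> obtain i where i: "a $ i - b $ i \<notin> \<int>" by (auto simp: to_torus_eq_iff)
  define f where "f v = cis (2 * pi * (v $ i))" for v :: "real^2"
  have f_eq: "f v = f w \<longleftrightarrow> v $ i - w $ i \<in> \<int>" for v w
  proof -
    have "f v = f w \<longleftrightarrow> cis (2 * pi * (v $ i - w $ i)) = 1"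
      unfolding f_def right_diff_distrib cis_divide[symmetric] by simp
    also have "\<dots> \<longleftrightarrow> v $ i - w $ i \<in> \<int>"
    proof
      assume "cis (2 * pi * (v $ i - w $ i)) = 1"
      then have "cos (2 * pi * (v $ i - w $ i)) = 1" by (simp add: complex_eq_iff)
      then obtain n :: int where "2 * pi * (v $ i - w $ i) = of_int n * 2 * pi"
        by (auto simp: cos_one_2pi_int)
      then have "v $ i - w $ i = of_int n" by simp
      then show "v $ i - w $ i \<in> \<int>" by simp
    qed (rule cis_multiple_2pi)
    finally show ?thesis .
  qed
  have cont: "continuous_on UNIV f"
    unfolding f_def by (intro continuous_intros)
  from i f_eq have "f a \<noteq> f b" by blast
  from hausdorff[OF this] obtain A B where AB: "open A" "open B" "f a \<in> A" "f b \<in> B" "A \<inter> B = {}"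
    by blast
  have pre: "to_torus -` (to_torus ` (f -` C)) = f -` C" for C
  proof (intro equalityI subsetI)
    fix v assume "v \<in> to_torus -` (to_torus ` (f -` C))"
    then obtain w where "f w \<in> C" "to_torus v = to_torus w" by auto
    then show "v \<in> f -` C" using f_eq[of v w] by (simp add: to_torus_eq_iff)
  qed auto
  have op: "open (to_torus ` (f -` C))" if "open C" for C
    unfolding open_torus2_def pre using cont that by (simp add: continuous_on_open_vimage)
  have "to_torus ` (f -` A) \<inter> to_torus ` (f -` B) = {}"
  proof (rule ccontr)
    assume "\<not> ?thesis"
    then obtain v where "v \<in> to_torus -` (to_torus ` (f -` A))" "v \<in> to_torus -` (to_torus ` (f -` B))"
      by blast
    then show False unfolding pre using AB by blast
  qed
  then show "\<exists>U V. open U \<and> open V \<and> x \<in> U \<and> y \<in> V \<and> U \<inter> V = {}"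
    using op AB ab by (intro exI[of _ "to_torus ` (f -` A)"] exI[of _ "to_torus ` (f -` B)"]) auto
qed


subsection \<open>Hyperbolic automorphisms\<close>

definition real_mat :: "int^2^2 \<Rightarrow> real^2^2" where
  "real_mat M = map_matrix of_int M"

lift_definition torus_aut :: "int^2^2 \<Rightarrow> torus2 \<Rightarrow> torus2" is "\<lambda>M v. real_mat M *v v"
proof -
  fix M :: "int^2^2" and v w :: "real^2"
  assume vw: "torus_rel v w"
  have "(real_mat M *v v) $ i - (real_mat M *v w) $ i \<in> \<int>" for i
  proof -
    have "(real_mat M *v v) $ i - (real_mat M *v w) $ i =
        (\<Sum>j\<in>UNIV. of_int (M $ i $ j) * (v $ j - w $ j))"
      by (simp add: matrix_vector_mult_def real_mat_def right_diff_distrib sum_subtractf)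
    also have "\<dots> \<in> \<int>"
      using vw unfolding torus_rel_def by (intro Ints_sum Ints_mult) auto
    finally show ?thesis .
  qed
  then show "torus_rel (real_mat M *v v) (real_mat M *v w)" unfolding torus_rel_def by blast
qed

text \<open>No complex eigenvalue on the unit circle.\<close>

definition hyperbolic :: "int^2^2 \<Rightarrow> bool" where
  "hyperbolic M \<longleftrightarrow>
     (\<forall>z v. (map_matrix of_int M :: complex^2^2) *v v = z *s v \<and> v \<noteq> 0 \<longrightarrow> norm z \<noteq> 1)"

lemma hyperbolic_iff:
  assumes "invertible M" "trace M > 0"
  shows "hyperbolic M \<longleftrightarrow> (det M = -1 \<and> trace M \<ge> 1) \<or> (det M = 1 \<and> trace M \<ge> 3)"
proof -
  let ?r = "trace M" and ?C = "map_matrix of_int M :: complex^2^2"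
  obtain M' where "M ** M' = mat 1" using assms(1) unfolding invertible_def by blast
  then have "det M * det M' = 1" by (metis det_I det_mul)
  then have det: "det M = 1 \<or> det M = -1" by (auto simp: zmult_eq_1_iff)
  have tr: "?r = M$1$1 + M$2$2" by (simp add: trace_def sum_2)
  have dt: "det M = M$1$1 * M$2$2 - M$1$2 * M$2$1" by (simp add: det_2)
  have ev: "(?C *v v = z *s v) \<longleftrightarrow>
      of_int (M$1$1) * v$1 + of_int (M$1$2) * v$2 = z * v$1 \<and>
      of_int (M$2$1) * v$1 + of_int (M$2$2) * v$2 = z * v$2" for z v
    by (simp add: vec_eq_iff forall_2 matrix_vector_mult_def sum_2)
  have char: "(\<exists>v. ?C *v v = z *s v \<and> v \<noteq> 0) \<longleftrightarrow> z^2 - of_int ?r * z + of_int (det M) = 0"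
    (is "?L \<longleftrightarrow> ?R") for z
  proof
    assume ?L
    then obtain v where v: "?C *v v = z *s v" "v \<noteq> 0" by blast
    let ?p = "z^2 - of_int ?r * z + of_int (det M)"
    have "?p * v$1 = 0" "?p * v$2 = 0"
      using v(1) unfolding ev tr dt of_int_add of_int_diff of_int_mult by algebra+
    with v(2) show ?R by (auto simp: vec_eq_iff forall_2)
  next
    assume p: ?R
    show ?L
    proof (cases "M$1$2 = 0 \<and> z = of_int (M$1$1)")
      case False
      let ?v = "vector [of_int (M$1$2), z - of_int (M$1$1)] :: complex^2"
      have "?C *v ?v = z *s ?v"
        using p unfolding ev tr dt of_int_add of_int_diff of_int_mult vector_2
        by (intro conjI) algebra+
      moreover have "?v \<noteq> 0" using False by (auto simp: vec_eq_iff forall_2)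
      ultimately show ?thesis by blast
    next
      case True
      show ?thesis
      proof (cases "M$2$1 = 0 \<and> z = of_int (M$2$2)")
        case False
        let ?v = "vector [z - of_int (M$2$2), of_int (M$2$1)] :: complex^2"
        have "?C *v ?v = z *s ?v"
          using p unfolding ev tr dt of_int_add of_int_diff of_int_mult vector_2
          by (intro conjI; (algebra | simp add: algebra_simps))
        moreover have "?v \<noteq> 0" using False by (auto simp: vec_eq_iff forall_2)
        ultimately show ?thesis by blast
      next
        case False': True
        let ?v = "vector [1, 0] :: complex^2"
        have "?C *v ?v = z *s ?v" using True False' by (simp add: ev)
        moreover have "?v \<noteq> 0" by (auto simp: vec_eq_iff forall_2)
        ultimately show ?thesis by blast
      qed
    qed
  qed
  have hyp: "hyperbolic M \<longleftrightarrow> (\<forall>z::complex. z^2 - of_int ?r * z + of_int (det M) = 0 \<longrightarrow> norm z \<noteq> 1)"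
    unfolding hyperbolic_def using char by blast
  from det show ?thesis
  proof
    assume d: "det M = 1"
    have "norm z \<noteq> 1" if r: "?r \<ge> 3" and z: "z^2 - of_int ?r * z + 1 = 0" for z :: complex
    proof
      assume n: "norm z = 1"
      then have "z * cnj z = 1" by (simp add: complex_norm_square[symmetric])
      then have "z + cnj z = of_int ?r" using z by algebra
      then have "2 * Re z = of_int ?r" by (simp add: complex_eq_iff)
      moreover have "Re z \<le> 1" using complex_Re_le_cmod[of z] n by simp
      ultimately show False using r by linarith
    qed
    moreover have "\<exists>z::complex. z^2 - of_int ?r * z + 1 = 0 \<and> norm z = 1" if r: "?r < 3"
    proof -
      let ?a = "of_int ?r / 2 :: real"
      have a: "0 \<le> ?a" "?a \<le> 1" using r assms(2) by auto
      then have sq: "(sqrt (1 - ?a^2))^2 = 1 - ?a^2" by (simp add: power_le_one)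
      let ?z = "Complex ?a (sqrt (1 - ?a^2))"
      have "norm ?z = 1" unfolding complex_norm using sq by simp
      moreover have "?z^2 - of_int ?r * ?z + 1 = 0"
        using sq by (simp add: complex_eq_iff power2_eq_square field_simps)
      ultimately show ?thesis by blast
    qed
    ultimately show ?thesis unfolding hyp using d by force
  next
    assume d: "det M = -1"
    have "norm z \<noteq> 1" if z: "z^2 - of_int ?r * z - 1 = 0" for z :: complex
    proof
      assume n: "norm z = 1"
      then have "z * cnj z = 1" by (simp add: complex_norm_square[symmetric])
      then have "z - cnj z = of_int ?r" using z by algebra
      then have "of_int ?r = (0::real)" by (simp add: complex_eq_iff)
      then show False using assms(2) by simp
    qed
    then show ?thesis unfolding hyp using d assms(2) by auto
  qed
qed

definition discr :: "int^2^2 \<Rightarrow> int" where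
  "discr M = (trace M)^2 - 4 * det M"

definition lam :: "int^2^2 \<Rightarrow> real" where
  "lam M = (of_int (trace M) + sqrt (of_int (discr M))) / 2"

text \<open>Integer iterates of a bijection.\<close>

definition iter :: "('a \<Rightarrow> 'a) \<Rightarrow> int \<Rightarrow> 'a \<Rightarrow> 'a" where
  "iter f n = (if n \<ge> 0 then f ^^ nat n else (inv f) ^^ nat (- n))"

definition homoclinic :: "int^2^2 \<Rightarrow> torus2 \<Rightarrow> bool" where
  "homoclinic M x \<longleftrightarrow>
     (\<lambda>n. iter (torus_aut M) (int n) x) \<longlonglongrightarrow> 0 \<and>
     (\<lambda>n. iter (torus_aut M) (- int n) x) \<longlonglongrightarrow> 0"

text \<open>Homoclinic points in coordinates of the plane: their lifts to the eigenline of \<open>lam M\<close>.\<close>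

definition homoclinic_coords :: "int^2^2 \<Rightarrow> (real^2) set" where
  "homoclinic_coords M =
     {t. real_mat M *v t = lam M *\<^sub>R t \<and> homoclinic M (to_torus t)}"


subsection \<open>Sequence spaces\<close>

definition Xtilde :: "int^2^2 \<Rightarrow> (int \<Rightarrow> nat) set" where
  "Xtilde M = {\<epsilon>. summable (\<lambda>k. real (\<epsilon> (int (Suc k))) / lam M ^ Suc k) \<and>
                  summable (\<lambda>k. real (\<epsilon> (- int (Suc k))) / lam M ^ Suc k)}"

definition shift :: "(int \<Rightarrow> nat) \<Rightarrow> int \<Rightarrow> nat" where
  "shift \<epsilon> = (\<lambda>n. \<epsilon> (n + 1))"

definition finite_seqs :: "(int \<Rightarrow> nat) set" where
  "finite_seqs = {\<epsilon>. finite {n. \<epsilon> n \<noteq> 0}}"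

definition tail :: "(int \<Rightarrow> nat) \<Rightarrow> int \<Rightarrow> nat \<Rightarrow> nat" where
  "tail \<epsilon> N = (\<lambda>k. \<epsilon> (N + int k))"

definition lex_less :: "(nat \<Rightarrow> nat) \<Rightarrow> (nat \<Rightarrow> nat) \<Rightarrow> bool" where
  "lex_less a b \<longleftrightarrow> (\<exists>n. (\<forall>m<n. a m = b m) \<and> a n < b n)"

definition lex_le :: "(nat \<Rightarrow> nat) \<Rightarrow> (nat \<Rightarrow> nat) \<Rightarrow> bool" where
  "lex_le a b \<longleftrightarrow> lex_less a b \<or> a = b"

text \<open>
  Every tail of the new sequence, to the left of \<open>N\<close> as well, is compared with the tail of the
  old one at \<open>N\<close>. With the tails from \<open>N\<close> onwards only, the coordinates left of \<open>N\<close> would be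
  unconstrained, and neither \<open>X_comp M\<close> nor \<open>Y_comp M\<close> would be total. The comparison is
  non-strict: with a strict one, for determinant \<open>-1\<close> and trace \<open>r \<ge> 2\<close>, the set \<open>X_comp M\<close>
  together with all shifts of the sequence
  \<open>\<dots>, 1, 1, r, 1, 0, 0, \<dots>\<close> would also satisfy all requirements on the second component of a
  coding.
\<close>

definition lex_total :: "int^2^2 \<Rightarrow> (int \<Rightarrow> nat) set \<Rightarrow> bool" where
  "lex_total M X \<longleftrightarrow>
     (\<forall>\<epsilon>\<in>X. \<forall>\<epsilon>'\<in>Xtilde M. \<forall>N. (\<forall>k::int. lex_le (tail \<epsilon>' (N + k)) (tail \<epsilon> N)) \<longrightarrow> \<epsilon>' \<in> X)"

definition X_comp :: "int^2^2 \<Rightarrow> (int \<Rightarrow> nat) set" where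
  "X_comp M = {\<epsilon>. \<forall>n. int (\<epsilon> n) \<le> trace M \<and> (int (\<epsilon> n) = trace M \<longrightarrow> \<epsilon> (n + 1) = 0)}"

definition Y_comp :: "int^2^2 \<Rightarrow> (int \<Rightarrow> nat) set" where
  "Y_comp M = {\<epsilon>. (\<forall>n. int (\<epsilon> n) \<le> trace M - 1) \<and>
     \<not> (\<exists>n. \<exists>j::nat. int (\<epsilon> n) = trace M - 1 \<and>
           (\<forall>i\<in>{1..j}. int (\<epsilon> (n + int i)) = trace M - 2) \<and>
           int (\<epsilon> (n + int j + 1)) = trace M - 1)}"


subsection \<open>Arithmetic codings\<close>

text \<open>
  A map with domain \<open>Xtilde M\<close> is a total function that is \<open>undefined\<close> elsewhere (\<open>extensional\<close>).

  Continuity refers to coordinatewise convergence (the product topology on \<^typ>\<open>int \<Rightarrow> nat\<close>) on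
  each set of sequences dominated by a fixed member of \<open>Xtilde M\<close>. On the whole of \<open>Xtilde M\<close> it
  would force the homomorphism to vanish: if \<open>c n\<close> is any multiplicity and \<open>e n\<close> the \<open>n\<close>-th unit
  sequence, then \<open>c n\<close> times \<open>e n\<close> tends to zero coordinatewise, while its image \<open>c n\<close> times
  \<open>\<phi> (e n)\<close> stays away from zero for suitable \<open>c n\<close> as soon as \<open>\<phi> (e 0) \<noteq> 0\<close>.
\<close>

definition coding_map :: "int^2^2 \<Rightarrow> ((int \<Rightarrow> nat) \<Rightarrow> torus2) \<Rightarrow> bool" where
  "coding_map M \<phi> \<longleftrightarrow>
     \<phi> \<in> extensional (Xtilde M) \<and>
     (\<forall>\<delta>\<in>Xtilde M. continuous_on {\<epsilon>. \<forall>n. \<epsilon> n \<le> \<delta> n} \<phi>) \<and>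
     (\<forall>\<epsilon>\<in>Xtilde M. \<forall>\<epsilon>'\<in>Xtilde M. \<phi> (\<lambda>n. \<epsilon> n + \<epsilon>' n) = \<phi> \<epsilon> + \<phi> \<epsilon>') \<and>
     (\<forall>\<epsilon>\<in>Xtilde M. \<phi> (shift \<epsilon>) = torus_aut M (\<phi> \<epsilon>))"

definition arithmetic_coding ::
    "int^2^2 \<Rightarrow> ((int \<Rightarrow> nat) \<Rightarrow> torus2) \<Rightarrow> (int \<Rightarrow> nat) set \<Rightarrow> bool" where
  "arithmetic_coding M \<phi> X \<longleftrightarrow>
     coding_map M \<phi> \<and>
     X \<subseteq> Xtilde M \<and> closedin (top_of_set (Xtilde M)) X \<and> shift ` X = X \<and>
     lex_total M X \<and>
     \<phi> ` X = UNIV \<and> inj_on \<phi> (X \<inter> finite_seqs)"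

definition phi :: "int^2^2 \<Rightarrow> real^2 \<Rightarrow> (int \<Rightarrow> nat) \<Rightarrow> torus2" where
  "phi M t = (\<lambda>\<epsilon>\<in>Xtilde M. lim (\<lambda>N. to_torus
     (\<Sum>n = - int N..int N. real (\<epsilon> n) *\<^sub>R iter ((*v) (real_mat M)) (- n) t)))"

end

theory Submission
  imports Defs
begin

text \<open>
  A homoclinic point is the class of some \<open>t = s + p\<close> with \<open>t\<close> on the unstable line, \<open>s\<close> on the
  stable line and \<open>p\<close> integral. Modulo the lattice, \<open>\<Sum> \<epsilon>\<^sub>n \<lambda>\<^sup>-\<^sup>n t\<close> is therefore the sum of a
  convergent series along \<open>t\<close> for \<open>n \<ge> 0\<close> and a convergent series along \<open>s\<close> for \<open>n < 0\<close>. A coding map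
  sends the unit sequence at \<open>0\<close> to a homoclinic point by continuity, and is determined by it.

  In both cases the compactum consists of the sequences all of whose tails are lexicographically at
  most \<open>w\<close>, the quasi-greedy expansion of \<open>1\<close> in base \<open>\<lambda>\<close>. Greedy expansions show that its image
  contains a half-line of irrational slope, and by compactness it is everything; expansions in base
  \<open>\<lambda>\<close> being unique on finite sequences gives injectivity. If another set \<open>X\<close> has a
  tail above \<open>w\<close>, totality puts both sides of a relation such as \<open>\<lambda>\<^sup>2 = r \<lambda> + 1\<close> into \<open>X\<close>. If
  all tails are at most \<open>w\<close> but some prefix of \<open>w\<close> is missing, \<open>X\<close> has only \<open>o(\<lambda>\<^sup>n)\<close> words of
  length \<open>n\<close>, too few to cover the torus. If no prefix is missing, totality yields all finite
  sequences of the compactum, and these are dense.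
\<close>

subsection \<open>Lexicographic order and quasi-greedy expansions\<close>

text \<open>The condition on tails treats both determinants at once, with \<open>w\<close> equal to
  \<open>r, 0, r, 0, ...\<close> for determinant -1 and to \<open>r - 1, r - 2, r - 2, ...\<close>
  for determinant 1. The decisive property of \<open>w\<close> is that infinitely many of its digits
  are nonzero. This keeps every partial sum of an admissible sequence strictly below 1, from which
  uniqueness of finite expansions follows. It also forces a finite sequence of the compactum to drop
  below \<open>w\<close> within a bounded number of places, so that one long prefix of
  \<open>w\<close> in \<open>X\<close> dominates all its tails. The obstacle to uniqueness of
  \<open>X\<close> is that a coding has to be one-to-one on finite sequences only. A smaller closed
  set therefore cannot be excluded by injectivity, and surjectivity has to be used quantitatively,
  by comparing numbers of words with the size of the torus.\<close>

lemma lex_less_linear: "a \<noteq> b \<Longrightarrow> lex_less a b \<or> lex_less b a"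
proof -
  assume "a \<noteq> b"
  then have "\<exists>n. a n \<noteq> b n" by auto
  then obtain n where "a n \<noteq> b n" "\<And>m. m < n \<Longrightarrow> a m = b m"
    using exists_least_iff[of "\<lambda>n. a n \<noteq> b n"] by auto
  then show ?thesis unfolding lex_less_def by (metis nat_neq_iff)
qed

lemma lex_less_trans: "lex_less a b \<Longrightarrow> lex_less b c \<Longrightarrow> lex_less a c"
proof -
  assume "lex_less a b" "lex_less b c"
  then obtain m n where mn: "\<forall>i<m. a i = b i" "a m < b m" "\<forall>i<n. b i = c i" "b n < c n"
    unfolding lex_less_def by blast
  show ?thesis unfolding lex_less_def
  proof (intro exI conjI allI impI)
    show "a i = c i" if "i < min m n" for i using mn that by simp
    show "a (min m n) < c (min m n)"
      using mn by (cases m n rule: linorder_cases) (auto simp: min_def)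
  qed
qed

lemma lex_less_irrefl: "\<not> lex_less a a"
  by (simp add: lex_less_def)

lemma not_lex_le: "\<not> lex_le a b \<longleftrightarrow> lex_less b a"
  unfolding lex_le_def using lex_less_linear lex_less_trans lex_less_irrefl by metis

lemma lex_le_trans: "lex_le a b \<Longrightarrow> lex_le b c \<Longrightarrow> lex_le a c"
  unfolding lex_le_def using lex_less_trans by metis

lemma lex_le_if_le: "(\<And>i. a i \<le> b i) \<Longrightarrow> lex_le a b"
  by (rule ccontr) (auto simp: not_lex_le lex_less_def leD)

text \<open>The comparison as seen through the first \<open>n\<close> places: either nothing is
  decided yet or the drop has already occurred. Arguments about finite words and partial sums use it
  in this form.\<close>

lemma lex_le_cases:
  assumes "lex_le a b"
  obtains "\<And>i. i < n \<Longrightarrow> a i = b i" | i where "i < n" "\<And>j. j < i \<Longrightarrow> a j = b j" "a i < b i"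
proof (cases "a = b")
  case False
  then obtain i where i: "\<forall>j<i. a j = b j" "a i < b i"
    using assms unfolding lex_le_def lex_less_def by blast
  show ?thesis
  proof (cases "i < n")
    case True
    then show ?thesis using i that(2) by blast
  next
    case False
    then show ?thesis using i that(1) by (meson le_less_trans not_less order.strict_trans)
  qed
qed (use that(1) in simp)

lemma lex_le_head: "lex_le a b \<Longrightarrow> a 0 \<le> b 0"
  unfolding lex_le_def lex_less_def by (metis gr_zeroI less_imp_le order_refl)

lemma tail_tail: "(\<lambda>i. tail \<epsilon> n (k + i)) = tail \<epsilon> (n + int k)"
  by (simp add: tail_def fun_eq_iff add.assoc)

lemma finite_seqs_bound:
  assumes "\<epsilon> \<in> finite_seqs"
  obtains K where "\<And>n. int K < \<bar>n\<bar> \<Longrightarrow> \<epsilon> n = 0"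
proof -
  have "finite ((\<lambda>n. nat \<bar>n\<bar>) ` {n. \<epsilon> n \<noteq> 0})" using assms by (simp add: finite_seqs_def)
  then obtain K where "\<forall>k\<in>(\<lambda>n. nat \<bar>n\<bar>) ` {n. \<epsilon> n \<noteq> 0}. k \<le> K"
    using finite_nat_set_iff_bounded_le by blast
  then have "\<epsilon> n = 0" if "int K < \<bar>n\<bar>" for n using that by force
  then show ?thesis using that by blast
qed


text \<open>Parry's characterization of the quasi-greedy expansion of 1.
  \<open>infinite_support\<close> separates it from a finite greedy expansion: for determinant -1
  the digits \<open>r, 1, 0, 0, ...\<close> also represent 1 and dominate their own tails.\<close>

locale quasi_greedy =
  fixes \<beta> :: real and w :: "nat \<Rightarrow> nat"
  assumes beta_gt_1: "1 < \<beta>"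
    and sums_one: "(\<lambda>i. real (w i) / \<beta> ^ Suc i) sums 1"
    and infinite_support: "\<exists>i\<ge>n. w i \<noteq> 0"
    and self_admissible: "lex_le (\<lambda>i. w (k + i)) w"
begin

definition admissible :: "(nat \<Rightarrow> nat) \<Rightarrow> bool" where
  "admissible a \<longleftrightarrow> (\<forall>k. lex_le (\<lambda>i. a (k + i)) w)"

definition shift_space :: "(int \<Rightarrow> nat) set" where
  "shift_space = {\<epsilon>. \<forall>n. lex_le (tail \<epsilon> n) w}"

lemma beta_pos [simp]: "0 < \<beta>" "0 \<le> \<beta>" "\<beta> \<noteq> 0" using beta_gt_1 by auto

lemma admissible_le: "admissible a \<Longrightarrow> a k \<le> w 0"
  unfolding admissible_def using lex_le_head[of "\<lambda>i. a (k + i)" w] by auto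

lemma admissible_drop: "admissible a \<Longrightarrow> admissible (\<lambda>i. a (k + i))"
  unfolding admissible_def by (metis (no_types, lifting) add.assoc ext)

lemma admissible_w: "admissible w"
  unfolding admissible_def using self_admissible by blast

lemma shift_space_iff: "\<epsilon> \<in> shift_space \<longleftrightarrow> (\<forall>n. admissible (tail \<epsilon> n))"
  unfolding shift_space_def admissible_def tail_tail mem_Collect_eq
  by (metis add.right_neutral of_nat_0)

lemma w0_pos: "0 < w 0"
proof (rule ccontr)
  assume "\<not> 0 < w 0"
  then have "w k = 0" for k using admissible_le[OF admissible_w, of k] by simp
  with infinite_support show False by metis
qed

text \<open>Strict because some digit beyond \<open>n\<close> still contributes a positive amount to
  the total 1.\<close>

lemma partial_w_lt_1: "(\<Sum>i<n. real (w i) / \<beta> ^ Suc i) < 1"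
proof -
  obtain i where i: "i \<ge> n" "w i \<noteq> 0" using infinite_support by blast
  have "(\<Sum>i<n. real (w i) / \<beta> ^ Suc i) \<le> (\<Sum>i<i. real (w i) / \<beta> ^ Suc i)"
    using i by (intro sum_mono2) (auto intro!: divide_nonneg_nonneg mult_nonneg_nonneg)
  also have "\<dots> < (\<Sum>i<Suc i. real (w i) / \<beta> ^ Suc i)" using i by simp
  also have "\<dots> \<le> 1"
    using sum_le_suminf[OF sums_summable[OF sums_one], of "{..<Suc i}"] sums_unique[OF sums_one] by simp
  finally show ?thesis .
qed

text \<open>The remainder after place \<open>i\<close> is written as a rescaled partial sum of a
  shifted sequence, since shifts of admissible sequences are admissible.\<close>

lemma sum_head_tail:
  assumes "i < n"
  shows "(\<Sum>j<n. real (a j) / \<beta> ^ Suc j) =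
    (\<Sum>j<i. real (a j) / \<beta> ^ Suc j) + real (a i) / \<beta> ^ Suc i
      + (\<Sum>j<n - Suc i. real (a (Suc i + j)) / \<beta> ^ Suc j) / \<beta> ^ Suc i"
proof -
  have split: "(\<Sum>j<k + m. f j) = (\<Sum>j<k. f j) + (\<Sum>j<m. f (k + j))"
    for k m and f :: "nat \<Rightarrow> real"
    by (induction m) simp_all
  have "(\<Sum>j<n. real (a j) / \<beta> ^ Suc j) = (\<Sum>j<Suc i + (n - Suc i). real (a j) / \<beta> ^ Suc j)"
    using assms by simp
  also have "\<dots> = (\<Sum>j<Suc i. real (a j) / \<beta> ^ Suc j)
      + (\<Sum>j<n - Suc i. real (a (Suc i + j)) / \<beta> ^ Suc (Suc i + j))"
    by (rule split)
  finally show ?thesis by (simp add: sum_divide_distrib power_add mult_ac)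
qed

text \<open>At the first difference from \<^term>\<open>w\<close> the digit drops by at least one, and by induction
  the remainder is worth less than one unit of that digit.\<close>

lemma partial_lt_1:
  assumes "admissible a"
  shows "(\<Sum>i<n. real (a i) / \<beta> ^ Suc i) < 1"
  using assms
proof (induction n arbitrary: a rule: less_induct)
  case (less n)
  have "lex_le a w" using less.prems unfolding admissible_def by (drule_tac spec[of _ 0]) simp
  then show ?case
  proof (cases rule: lex_le_cases[of a w n])
    case 1
    then show ?thesis using partial_w_lt_1[of n] by simp
  next
    case (2 i)
    have "(\<Sum>j<n - Suc i. real (a (Suc i + j)) / \<beta> ^ Suc j) < 1"
      using less.IH[OF _ admissible_drop[OF less.prems, of "Suc i"], of "n - Suc i"] 2 by simp
    then have "(\<Sum>j<n - Suc i. real (a (Suc i + j)) / \<beta> ^ Suc j) / \<beta> ^ Suc i < 1 / \<beta> ^ Suc i"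
      by (intro divide_strict_right_mono) auto
    moreover have "(real (a i) + 1) / \<beta> ^ Suc i \<le> real (w i) / \<beta> ^ Suc i"
      using 2 by (intro divide_right_mono) auto
    moreover have "(\<Sum>j<i. real (a j) / \<beta> ^ Suc j) = (\<Sum>j<i. real (w j) / \<beta> ^ Suc j)"
      using 2 by simp
    ultimately show ?thesis
      using sum_head_tail[OF 2(1), of a] partial_w_lt_1[of "Suc i"] by (simp add: add_divide_distrib)
  qed
qed

text \<open>Iterating the beta-transformation \<open>frac (\<beta> * y)\<close> produces the greedy
  digits; \<open>T n\<close> is the remainder after \<open>n\<close> digits, rescaled to the unit
  interval.\<close>

lemma expansion_exists:
  assumes "0 \<le> x" "x < 1"
  obtains a where "admissible a" "(\<lambda>i. real (a i) / \<beta> ^ Suc i) sums x"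
proof -
  define T where "T n = ((\<lambda>y. frac (\<beta> * y)) ^^ n) x" for n
  define a where "a n = nat \<lfloor>\<beta> * T n\<rfloor>" for n
  have T: "0 \<le> T n" "T n < 1" for n
    using assms by (induction n) (auto simp: T_def frac_lt_1)
  have step: "T n = (real (a n) + T (Suc n)) / \<beta>" for n
  proof -
    have "real (a n) = of_int \<lfloor>\<beta> * T n\<rfloor>" using T(1)[of n] by (simp add: a_def)
    then show ?thesis by (simp add: T_def frac_def)
  qed
  have rem: "T k = (\<Sum>i<n. real (a (k + i)) / \<beta> ^ Suc i) + T (k + n) / \<beta> ^ n" for k n
  proof (induction n)
    case (Suc n)
    then show ?case using step[of "k + n"] by (simp add: add_divide_distrib)
  qed simp
  have "admissible a"
    unfolding admissible_def
  proof (intro allI, rule ccontr)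
    fix k assume "\<not> lex_le (\<lambda>i. a (k + i)) w"
    then obtain n where n: "\<And>j. j < n \<Longrightarrow> a (k + j) = w j" "w n < a (k + n)"
      unfolding not_lex_le lex_less_def by metis
    \<comment> \<open>The part of \<open>w\<close> after place \<open>n\<close> is worth at most one
      unit of that place. Raising digit \<open>n\<close> of \<open>w\<close> by one therefore
      reaches the value 1, which \<open>T k\<close> does not attain.\<close>
    have "1 \<le> (\<Sum>i<Suc n. real (w i) / \<beta> ^ Suc i) + 1 / \<beta> ^ Suc n"
    proof (rule LIMSEQ_le_const2)
      show "(\<lambda>m. \<Sum>i<m. real (w i) / \<beta> ^ Suc i) \<longlonglongrightarrow> 1" using sums_one by (simp add: sums_def)
      show "\<exists>N. \<forall>m\<ge>N. (\<Sum>i<m. real (w i) / \<beta> ^ Suc i)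
          \<le> (\<Sum>i<Suc n. real (w i) / \<beta> ^ Suc i) + 1 / \<beta> ^ Suc n"
      proof (intro exI allI impI)
        fix m assume "Suc n \<le> m"
        then have "n < m" by simp
        have "(\<Sum>j<m - Suc n. real (w (Suc n + j)) / \<beta> ^ Suc j) / \<beta> ^ Suc n \<le> 1 / \<beta> ^ Suc n"
          using partial_lt_1[OF admissible_drop[OF admissible_w], of "Suc n" "m - Suc n"]
          by (intro divide_right_mono) auto
        then show "(\<Sum>i<m. real (w i) / \<beta> ^ Suc i)
          \<le> (\<Sum>i<Suc n. real (w i) / \<beta> ^ Suc i) + 1 / \<beta> ^ Suc n"
          using sum_head_tail[OF \<open>n < m\<close>, of w] by simp
      qed
    qed
    also have "\<dots> = (\<Sum>i<n. real (w i) / \<beta> ^ Suc i) + (real (w n) + 1) / \<beta> ^ Suc n"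
      by (simp add: add_divide_distrib)
    also have "\<dots> \<le> (\<Sum>i<n. real (w i) / \<beta> ^ Suc i) + real (a (k + n)) / \<beta> ^ Suc n"
      using n(2) by (intro add_left_mono divide_right_mono) auto
    also have "\<dots> = (\<Sum>i<Suc n. real (a (k + i)) / \<beta> ^ Suc i)" using n(1) by simp
    also have "\<dots> \<le> T k" using rem[of k "Suc n"] T(1)[of "k + Suc n"] by simp
    finally show False using T(2)[of k] by simp
  qed
  moreover have "(\<lambda>i. real (a i) / \<beta> ^ Suc i) sums x"
  proof -
    have "(\<lambda>n. 1 / \<beta> ^ n) \<longlonglongrightarrow> 0"
      using LIMSEQ_inverse_realpow_zero[OF beta_gt_1] by (simp add: inverse_eq_divide)
    then have "(\<lambda>n. T n / \<beta> ^ n) \<longlonglongrightarrow> 0"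
    proof (rule tendsto_sandwich[OF _ _ tendsto_const, rotated 2])
      show "\<forall>\<^sub>F n in sequentially. T n / \<beta> ^ n \<le> 1 / \<beta> ^ n"
        using T(2) by (intro always_eventually allI divide_right_mono) (auto intro: less_imp_le)
    qed (use T(1) in \<open>auto intro!: always_eventually divide_nonneg_pos\<close>)
    then have "(\<lambda>n. x - T n / \<beta> ^ n) \<longlonglongrightarrow> x - 0" by (intro tendsto_diff tendsto_const)
    moreover have "x - T n / \<beta> ^ n = (\<Sum>i<n. real (a i) / \<beta> ^ Suc i)" for n
      using rem[of 0 n] by (simp add: T_def)
    ultimately show ?thesis by (simp add: sums_def)
  qed
  ultimately show ?thesis using that by blast
qed

text \<open>By \<open>partial_lt_1\<close>, one more unit at place \<open>i\<close> outweighs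
  whatever the admissible \<open>a\<close> carries after it.\<close>

lemma partial_lex_strict_mono:
  assumes "admissible a" "i < n" "\<And>j. j < i \<Longrightarrow> a j = b j" "a i < b i"
  shows "(\<Sum>j<n. real (a j) / \<beta> ^ Suc j) < (\<Sum>j<n. real (b j) / \<beta> ^ Suc j)"
proof -
  have "(\<Sum>j<n - Suc i. real (a (Suc i + j)) / \<beta> ^ Suc j) / \<beta> ^ Suc i < 1 / \<beta> ^ Suc i"
    using partial_lt_1[OF admissible_drop[OF assms(1), of "Suc i"], of "n - Suc i"]
    by (intro divide_strict_right_mono) auto
  moreover have "(real (a i) + 1) / \<beta> ^ Suc i \<le> real (b i) / \<beta> ^ Suc i"
    using assms by (intro divide_right_mono) auto
  moreover have "0 \<le> (\<Sum>j<n - Suc i. real (b (Suc i + j)) / \<beta> ^ Suc j) / \<beta> ^ Suc i"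
    by (intro divide_nonneg_nonneg sum_nonneg) auto
  moreover have "(\<Sum>j<i. real (a j) / \<beta> ^ Suc j) = (\<Sum>j<i. real (b j) / \<beta> ^ Suc j)"
    using assms by simp
  ultimately show ?thesis
    using sum_head_tail[OF assms(2), of a] sum_head_tail[OF assms(2), of b]
    by (simp add: add_divide_distrib)
qed

lemma partial_inj:
  assumes "admissible a" "admissible b" "j < n"
    and eq: "(\<Sum>j<n. real (a j) / \<beta> ^ Suc j) = (\<Sum>j<n. real (b j) / \<beta> ^ Suc j)"
  shows "a j = b j"
proof (rule ccontr)
  assume "a j \<noteq> b j"
  define i where "i = (LEAST k. a k \<noteq> b k)"
  have "a i \<noteq> b i" unfolding i_def using \<open>a j \<noteq> b j\<close> by (rule LeastI)
  moreover have "i < n"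
    using Least_le[of "\<lambda>k. a k \<noteq> b k" j] \<open>a j \<noteq> b j\<close> assms(3) by (simp add: i_def)
  moreover have "a k = b k" if "k < i" for k
    using not_less_Least[of k "\<lambda>k. a k \<noteq> b k"] that by (auto simp: i_def)
  ultimately show False
    using partial_lex_strict_mono[OF assms(1), of i n b] partial_lex_strict_mono[OF assms(2), of i n a] eq
    by (metis less_irrefl linorder_neqE_nat)
qed

lemma shift_space_mono:
  assumes "\<epsilon> \<in> shift_space" "\<And>n. \<epsilon>' n \<le> \<epsilon> n"
  shows "\<epsilon>' \<in> shift_space"
proof -
  have "lex_le (tail \<epsilon>' n) (tail \<epsilon> n)" for n
    using assms(2) by (intro lex_le_if_le) (simp add: tail_def)
  then show ?thesis using assms(1) lex_le_trans unfolding shift_space_def by blast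
qed

lemma shift_space_le: "\<epsilon> \<in> shift_space \<Longrightarrow> \<epsilon> n \<le> w 0"
  using lex_le_head[of "tail \<epsilon> n" w] by (auto simp: shift_space_def tail_def)

text \<open>Finite support of \<open>y\<close> is played off against infinite support of
  \<open>w\<close>. The nonzero digits of \<open>y\<close> are at most \<open>2 * K\<close> apart,
  whereas \<open>w 0\<close> and \<open>w m\<close> are nonzero with \<open>m\<close> larger than
  that. So each tail of \<open>y\<close> drops below \<open>w\<close> by place \<open>m\<close>, and
  any sequence sharing this prefix with \<open>w\<close> dominates it.\<close>

lemma tails_below_prefix:
  assumes y: "y \<in> shift_space" "y \<in> finite_seqs"
  obtains m where "\<And>a n. (\<And>i. i \<le> m \<Longrightarrow> a i = w i) \<Longrightarrow> lex_le (tail y n) a"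
proof -
  obtain K where "\<And>n. int K < \<bar>n\<bar> \<Longrightarrow> y n = 0" using finite_seqs_bound[OF y(2)] by blast
  then have K: "\<And>n. y n \<noteq> 0 \<Longrightarrow> \<bar>n\<bar> \<le> int K" by (meson not_less)
  obtain m where m: "m \<ge> 2 * K + 1" "w m \<noteq> 0" using infinite_support by blast
  show ?thesis
  proof (rule that)
    fix a n assume a: "\<And>i. i \<le> m \<Longrightarrow> a i = w i"
    have "lex_le (tail y n) w" using y by (simp add: shift_space_def)
    then consider "\<And>i. i < Suc m \<Longrightarrow> tail y n i = w i"
      | i where "i < Suc m" "\<And>j. j < i \<Longrightarrow> tail y n j = w j" "tail y n i < w i"
      by (rule lex_le_cases[where n = "Suc m"]) blast+
    then show "lex_le (tail y n) a"
    proof cases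
      case 1
      have "y n \<noteq> 0" "y (n + int m) \<noteq> 0"
        using 1[of 0] 1[of m] w0_pos m(2) by (auto simp: tail_def)
      then have "\<bar>n\<bar> \<le> int K" "\<bar>n + int m\<bar> \<le> int K" by (auto intro: K)
      then show ?thesis using m(1) by linarith
    next
      case 2
      then show ?thesis using a unfolding lex_le_def lex_less_def
        by (intro disjI1 exI[of _ i]) auto
    qed
  qed
qed

section \<open>Growth of the number of words when a prefix of \<open>w\<close> is avoided\<close>

definition words :: "(int \<Rightarrow> nat) set \<Rightarrow> nat \<Rightarrow> nat list set" where
  "words S n = {map (tail \<epsilon> N) [0..<n] | \<epsilon> N. \<epsilon> \<in> S}"

text \<open>Avoiding the prefix of length \<open>m + 1\<close> forces the first drop below
  \<open>w\<close> to come by place \<open>m\<close>, which bounds the number of families in the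
  union independently of \<open>n\<close>.\<close>

lemma words_subset:
  assumes S: "S \<subseteq> shift_space" and avoid: "\<And>\<epsilon> N. \<epsilon> \<in> S \<Longrightarrow> \<exists>i\<le>m. tail \<epsilon> N i \<noteq> w i"
  shows "words S n \<subseteq> insert (map w [0..<n])
    (\<Union>i\<in>{..m} \<inter> {..<n}. \<Union>b\<in>{..<w i}. (\<lambda>l. map w [0..<i] @ b # l) ` words S (n - Suc i))"
    (is "_ \<subseteq> insert _ ?R")
proof
  fix l assume "l \<in> words S n"
  then obtain \<epsilon> N where eps: "\<epsilon> \<in> S" "l = map (tail \<epsilon> N) [0..<n]" by (auto simp: words_def)
  have "lex_le (tail \<epsilon> N) w" using S eps(1) by (auto simp: shift_space_def)
  then consider "\<And>i. i < n \<Longrightarrow> tail \<epsilon> N i = w i"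
    | i where "i < n" "\<And>j. j < i \<Longrightarrow> tail \<epsilon> N j = w j" "tail \<epsilon> N i < w i"
    by (rule lex_le_cases[where n = n]) blast+
  then show "l \<in> insert (map w [0..<n]) ?R"
  proof cases
    case 1
    then show ?thesis using eps(2) by simp
  next
    case (2 i)
    obtain k where k: "k \<le> m" "tail \<epsilon> N k \<noteq> w k" using avoid[OF eps(1)] by blast
    have "i \<le> m" using 2(2) k by (metis le_less_trans not_less)
    have "[0..<n] = [0..<i] @ i # [Suc i..<n]"
      using 2(1) by (metis le0 less_imp_le upt_add_eq_append upt_conv_Cons le_add_diff_inverse)
    moreover have "map (tail \<epsilon> N) [Suc i..<n] = map (tail \<epsilon> (N + int (Suc i))) [0..<n - Suc i]"
      by (rule nth_equalityI) (auto simp: tail_def algebra_simps)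
    ultimately have "l = map w [0..<i] @ tail \<epsilon> N i # map (tail \<epsilon> (N + int (Suc i))) [0..<n - Suc i]"
      using eps(2) 2(2) by simp
    moreover have "map (tail \<epsilon> (N + int (Suc i))) [0..<n - Suc i] \<in> words S (n - Suc i)"
      using eps(1) by (auto simp: words_def)
    ultimately show ?thesis using 2 \<open>i \<le> m\<close> by (intro insertI2) blast
  qed
qed

lemma finite_words:
  assumes "S \<subseteq> shift_space"
  shows "finite (words S n)"
proof (rule finite_subset)
  have "\<epsilon> k \<le> w 0" if "\<epsilon> \<in> S" for \<epsilon> k using assms that shift_space_le by blast
  then show "words S n \<subseteq> {xs. set xs \<subseteq> {..w 0} \<and> length xs = n}"
    by (auto simp: words_def tail_def)
qed (simp add: finite_lists_length_eq)

text \<open>Every word other than the prefix of \<^term>\<open>w\<close> has a first letter below \<^term>\<open>w\<close>, after which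
  an arbitrary word of the language may follow. Since the prefix of length \<open>m + 1\<close> is avoided,
  the weights in this renewal inequality have total mass less than one.\<close>

lemma summable_words:
  assumes S: "S \<subseteq> shift_space" and avoid: "\<And>\<epsilon> N. \<epsilon> \<in> S \<Longrightarrow> \<exists>i\<le>m. tail \<epsilon> N i \<noteq> w i"
  shows "summable (\<lambda>n. real (card (words S n)) / \<beta> ^ n)"
proof -
  define g where "g n = real (card (words S n)) / \<beta> ^ n" for n
  define c where "c i = real (w i) / \<beta> ^ Suc i" for i
  define s where "s = (\<Sum>i\<le>m. c i)"
  have pos: "g n \<ge> 0" "c n \<ge> 0" for n by (auto simp: g_def c_def)
  have s: "s < 1" using partial_w_lt_1[of "Suc m"] by (simp add: s_def c_def lessThan_Suc_atMost)
  \<comment> \<open>The term \<open>(1 / \<beta>) ^ n\<close> counts the single word that is a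
    prefix of \<open>w\<close>; \<open>c i\<close> combines the \<open>w i\<close> smaller letters
    at place \<open>i\<close> with the rescaling by \<open>\<beta> ^ Suc i\<close>.\<close>
  have rec: "g n \<le> (1 / \<beta>) ^ n + (\<Sum>i\<le>m. if i < n then c i * g (n - Suc i) else 0)" for n
  proof -
    let ?A = "\<lambda>i b. (\<lambda>l. map w [0..<i] @ b # l) ` words S (n - Suc i)"
    have "card (words S n) \<le> card (insert (map w [0..<n]) (\<Union>i\<in>{..m} \<inter> {..<n}. \<Union>b\<in>{..<w i}. ?A i b))"
      by (intro card_mono words_subset[OF assms]) (auto simp: finite_words[OF S])
    also have "\<dots> \<le> Suc (card (\<Union>i\<in>{..m} \<inter> {..<n}. \<Union>b\<in>{..<w i}. ?A i b))"
      by (rule card_insert_le_m1) simp_all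
    also have "card (\<Union>i\<in>{..m} \<inter> {..<n}. \<Union>b\<in>{..<w i}. ?A i b)
        \<le> (\<Sum>i\<in>{..m} \<inter> {..<n}. w i * card (words S (n - Suc i)))"
    proof (rule order.trans[OF card_UN_le], simp, rule sum_mono)
      fix i
      have "card (\<Union>b\<in>{..<w i}. ?A i b) \<le> (\<Sum>b<w i. card (?A i b))" by (rule card_UN_le) simp
      also have "\<dots> \<le> (\<Sum>b<w i. card (words S (n - Suc i)))"
        by (intro sum_mono card_image_le finite_words[OF S])
      finally show "card (\<Union>b\<in>{..<w i}. ?A i b) \<le> w i * card (words S (n - Suc i))" by simp
    qed
    finally have "real (card (words S n))
        \<le> 1 + (\<Sum>i\<in>{..m} \<inter> {..<n}. real (w i) * real (card (words S (n - Suc i))))"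
      by (simp flip: of_nat_mult of_nat_sum of_nat_Suc del: of_nat_Suc)
    then have "g n \<le> (1 + (\<Sum>i\<in>{..m} \<inter> {..<n}. real (w i) * real (card (words S (n - Suc i))))) / \<beta> ^ n"
      unfolding g_def by (intro divide_right_mono) auto
    also have "\<dots> = (1 / \<beta>) ^ n + (\<Sum>i\<in>{..m} \<inter> {..<n}. c i * g (n - Suc i))"
    proof -
      have "real (w i) * real (card (words S (n - Suc i))) / \<beta> ^ n = c i * g (n - Suc i)" if "i < n" for i
      proof -
        have "\<beta> ^ n = \<beta> ^ Suc i * \<beta> ^ (n - Suc i)"
          using that by (metis Suc_leI le_add_diff_inverse power_add)
        then show ?thesis by (simp add: c_def g_def)
      qed
      then show ?thesis
        by (simp add: add_divide_distrib sum_divide_distrib power_one_over)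
    qed
    also have "(\<Sum>i\<in>{..m} \<inter> {..<n}. c i * g (n - Suc i)) = (\<Sum>i\<le>m. if i < n then c i * g (n - Suc i) else 0)"
      by (subst sum.inter_restrict) (simp_all add: lessThan_iff)
    finally show ?thesis .
  qed
  have shifted: "(\<Sum>n<N. if i < n then g (n - Suc i) else 0) = (\<Sum>n<N - Suc i. g n)" for N i
  proof (induction N)
    case (Suc N)
    show ?case
    proof (cases "i < N")
      case True
      then have "N - i = Suc (N - Suc i)" by simp
      then show ?thesis using Suc True by simp
    qed (use Suc in simp)
  qed simp
  \<comment> \<open>Summing the renewal inequality bounds the partial sum of \<open>g\<close> by a
    geometric series plus \<open>s\<close> times itself; since \<open>s < 1\<close> this can be
    solved for the partial sum.\<close>
  have "(\<Sum>n<N. g n) \<le> (1 / (1 - 1 / \<beta>)) / (1 - s)" for N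
  proof -
    have "(\<Sum>n<N. g n) \<le> (\<Sum>n<N. (1 / \<beta>) ^ n + (\<Sum>i\<le>m. if i < n then c i * g (n - Suc i) else 0))"
      by (intro sum_mono rec)
    also have "\<dots> = (\<Sum>n<N. (1 / \<beta>) ^ n) + (\<Sum>i\<le>m. \<Sum>n<N. if i < n then c i * g (n - Suc i) else 0)"
      by (simp add: sum.distrib) (rule sum.swap)
    also have "(\<Sum>i\<le>m. \<Sum>n<N. if i < n then c i * g (n - Suc i) else 0)
        = (\<Sum>i\<le>m. c i * (\<Sum>n<N - Suc i. g n))"
      by (simp add: shifted[symmetric] sum_distrib_left if_distrib cong: if_cong)
    also have "\<dots> \<le> (\<Sum>i\<le>m. c i * (\<Sum>n<N. g n))"
      using pos by (intro sum_mono mult_left_mono sum_mono2) auto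
    also have "\<dots> = s * (\<Sum>n<N. g n)" by (simp add: s_def sum_distrib_right)
    also have "(\<Sum>n<N. (1 / \<beta>) ^ n) \<le> 1 / (1 - 1 / \<beta>)"
    proof -
      have "(\<Sum>n<N. (1 / \<beta>) ^ n) \<le> (\<Sum>n. (1 / \<beta>) ^ n)"
        using beta_gt_1 by (intro sum_le_suminf summable_geometric) auto
      then show ?thesis using suminf_geometric[of "1 / \<beta>"] beta_gt_1 by simp
    qed
    finally have "(1 - s) * (\<Sum>n<N. g n) \<le> 1 / (1 - 1 / \<beta>)" by (simp add: algebra_simps)
    then show ?thesis using s by (subst pos_le_divide_eq) (simp_all add: mult.commute)
  qed
  then have "summable g" using pos by (intro summableI_nonneg_bounded) auto
  then show ?thesis by (simp add: g_def[abs_def])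
qed

end


subsection \<open>Homoclinic points\<close>

lemma to_torus_add: "to_torus (a + b) = to_torus a + to_torus b"
  by (simp add: plus_torus2.abs_eq)

lemma to_torus_zero: "to_torus 0 = 0"
  by (simp add: zero_torus2.abs_eq)

lemma torus_aut_to_torus: "torus_aut M (to_torus v) = to_torus (real_mat M *v v)"
  by (simp add: torus_aut.abs_eq)

definition lattice :: "(real^2) set" where
  "lattice = {p. \<forall>i. p $ i \<in> \<int>}"

lemma to_torus_eq_lattice: "to_torus x = to_torus y \<longleftrightarrow> x - y \<in> lattice"
  by (simp add: to_torus_eq_iff lattice_def)

lemma lattice_add: "p \<in> lattice \<Longrightarrow> q \<in> lattice \<Longrightarrow> p + q \<in> lattice"
  and lattice_diff: "p \<in> lattice \<Longrightarrow> q \<in> lattice \<Longrightarrow> p - q \<in> lattice"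
  and lattice_zero: "0 \<in> lattice"
  by (auto simp: lattice_def)

lemma lattice_scaleR_nat: "p \<in> lattice \<Longrightarrow> real n *\<^sub>R p \<in> lattice"
  by (auto simp: lattice_def)

lemma lattice_sum: "(\<And>i. i \<in> I \<Longrightarrow> f i \<in> lattice) \<Longrightarrow> sum f I \<in> lattice"
  by (induction I rule: infinite_finite_induct) (auto intro: lattice_add lattice_zero)

lemma lattice_real_mat: "p \<in> lattice \<Longrightarrow> real_mat M *v p \<in> lattice"
  by (auto simp: lattice_def real_mat_def matrix_vector_mult_def intro!: Ints_sum Ints_mult)

lemma lattice_small: "p \<in> lattice \<Longrightarrow> norm p < 1 \<Longrightarrow> p = 0"
proof -
  assume p: "p \<in> lattice" "norm p < 1"
  have "p $ i = 0" for i
  proof -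
    have "p $ i \<in> \<int>" "\<bar>p $ i\<bar> < 1"
      using p component_le_norm_cart[of p i] by (auto simp: lattice_def)
    then show ?thesis by (auto elim!: Ints_cases)
  qed
  then show "p = 0" by (simp add: vec_eq_iff)
qed

lemma continuous_on_to_torus: "continuous_on S to_torus"
proof -
  have "continuous_on UNIV to_torus"
    by (subst continuous_on_open_vimage) (auto simp: open_torus2_def)
  then show ?thesis using continuous_on_subset by blast
qed

lemma tendsto_to_torus: "(f \<longlongrightarrow> v) F \<Longrightarrow> ((\<lambda>x. to_torus (f x)) \<longlongrightarrow> to_torus v) F"
  using continuous_on_tendsto_compose[OF continuous_on_to_torus[of UNIV]] by auto

text \<open>The full preimage of the image is the union of the lattice translates of
  \<open>S\<close>. Consequently points of the torus near 0 have small lifts.\<close>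

lemma open_to_torus_image:
  assumes "open S"
  shows "open (to_torus ` S)"
proof -
  have "to_torus -` (to_torus ` S) = (\<Union>p\<in>lattice. (+) p ` S)"
  proof (intro equalityI subsetI)
    fix x assume "x \<in> to_torus -` (to_torus ` S)"
    then obtain y where "y \<in> S" "x - y \<in> lattice" by (auto simp: to_torus_eq_lattice)
    then show "x \<in> (\<Union>p\<in>lattice. (+) p ` S)" by (intro UN_I[of "x - y"] image_eqI[of _ _ y]) auto
  next
    fix x assume "x \<in> (\<Union>p\<in>lattice. (+) p ` S)"
    then obtain p y where "p \<in> lattice" "y \<in> S" "x = p + y" by blast
    then show "x \<in> to_torus -` (to_torus ` S)"
      by (auto simp: to_torus_eq_lattice intro!: image_eqI[of _ _ y])
  qed
  then show ?thesis unfolding open_torus2_def using assms by (auto intro!: open_translation)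
qed

section \<open>Lifting convergent orbits from the torus to the plane\<close>

definition nearest :: "real^2 \<Rightarrow> real^2" where
  "nearest v = (\<chi> i. of_int (round (v $ i)))"

lemma nearest_lattice: "nearest v \<in> lattice"
  by (simp add: nearest_def lattice_def)

text \<open>A torus point near 0 has some small lift, and coordinatewise rounding leaves a defect no
  larger than that lift.\<close>

lemma tendsto_torus_zero_nearest:
  assumes "((\<lambda>n. to_torus (v n)) \<longlongrightarrow> 0) F"
  shows "((\<lambda>n. v n - nearest (v n)) \<longlongrightarrow> 0) F"
proof (rule vec_tendstoI)
  fix i
  show "((\<lambda>n. (v n - nearest (v n)) $ i) \<longlongrightarrow> 0 $ i) F"
    unfolding tendsto_iff
  proof (intro allI impI)
    fix e :: real assume "0 < e"
    have "open (to_torus ` ball 0 e)" by (intro open_to_torus_image open_ball)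
    moreover have "0 \<in> to_torus ` ball 0 e" using \<open>0 < e\<close> to_torus_zero by force
    ultimately have "\<forall>\<^sub>F n in F. to_torus (v n) \<in> to_torus ` ball 0 e"
      using assms by (simp add: topological_tendstoD)
    then show "\<forall>\<^sub>F n in F. dist ((v n - nearest (v n)) $ i) (0 $ i) < e"
    proof eventually_elim
      case (elim n)
      then obtain u where u: "norm u < e" "v n - u \<in> lattice" by (auto simp: to_torus_eq_lattice)
      then obtain k where k: "v n $ i - u $ i = of_int k" by (auto simp: lattice_def elim!: Ints_cases)
      have "\<bar>v n $ i - of_int (round (v n $ i))\<bar> \<le> \<bar>v n $ i - of_int k\<bar>" by (rule round_diff_minimal)
      also have "\<dots> = \<bar>u $ i\<bar>" using k by simp
      also have "\<dots> < e" using component_le_norm_cart[of u i] u(1) by simp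
      finally show ?case by (simp add: nearest_def dist_real_def)
    qed
  qed
qed

text \<open>The integer vectors nearest to an orbit that converges to the lattice eventually form an
  orbit themselves, because their defects are integral and tend to zero.\<close>

lemma torus_orbit_tendsto_zero:
  fixes A :: "real^2^2"
  assumes A: "\<And>p. p \<in> lattice \<Longrightarrow> A *v p \<in> lattice"
    and lim: "(\<lambda>n. to_torus (((*v) A ^^ n) v)) \<longlonglongrightarrow> 0"
  obtains N p where "p \<in> lattice" "(\<lambda>n. ((*v) A ^^ n) (((*v) A ^^ N) v - p)) \<longlonglongrightarrow> 0"
proof -
  define u where "u n = ((*v) A ^^ n) v" for n
  define m where "m n = nearest (u n)" for n
  have um: "(\<lambda>n. u n - m n) \<longlonglongrightarrow> 0"
    using tendsto_torus_zero_nearest[OF lim] by (simp add: u_def m_def)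
  have "(\<lambda>n. (u (Suc n) - m (Suc n)) - A *v (u n - m n)) \<longlonglongrightarrow> 0 - A *v 0"
    by (intro tendsto_diff LIMSEQ_Suc[OF um]
      bounded_linear.tendsto[OF matrix_vector_mul_bounded_linear um])
  moreover have "(u (Suc n) - m (Suc n)) - A *v (u n - m n) = A *v m n - m (Suc n)" for n
    by (simp add: u_def matrix_vector_mult_diff_distrib)
  ultimately have "(\<lambda>n. A *v m n - m (Suc n)) \<longlonglongrightarrow> 0" by simp
  then have "\<forall>\<^sub>F n in sequentially. norm (A *v m n - m (Suc n)) < 1"
    by (auto simp: tendsto_iff dist_norm)
  then obtain N where N: "\<And>n. n \<ge> N \<Longrightarrow> norm (A *v m n - m (Suc n)) < 1"
    by (auto simp: eventually_sequentially)
  have m: "m (Suc n) = A *v m n" if "n \<ge> N" for n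
    using lattice_small[OF _ N[OF that]] A by (simp add: m_def nearest_lattice lattice_diff)
  have "((*v) A ^^ n) (u N - m N) = u (n + N) - m (n + N)" for n
  proof (induction n)
    case (Suc n)
    then show ?case using m[of "n + N"] by (simp add: u_def matrix_vector_mult_diff_distrib)
  qed simp
  then have "(\<lambda>n. ((*v) A ^^ n) (u N - m N)) \<longlonglongrightarrow> 0"
    using LIMSEQ_ignore_initial_segment[OF um, of N] by simp
  then show ?thesis using that[of "m N" N] by (simp add: u_def m_def nearest_lattice)
qed

lemma funpow_eigen:
  fixes A :: "real^2^2"
  assumes "A *v v = c *\<^sub>R v"
  shows "((*v) A ^^ n) v = c ^ n *\<^sub>R v"
  by (induction n) (simp_all add: assms matrix_vector_mult_scaleR)

lemma iter_Suc: "bij f \<Longrightarrow> iter f (n + 1) x = f (iter f n x)"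
proof (cases "n \<ge> 0")
  case True
  then show ?thesis by (simp add: iter_def nat_add_distrib)
next
  case False
  assume "bij f"
  define k where "k = nat (- n - 1)"
  have k: "n = - int (Suc k)" using False by (simp add: k_def)
  have "iter f (n + 1) x = (inv f ^^ k) x" by (simp add: iter_def k)
  moreover have "iter f n x = inv f ((inv f ^^ k) x)" by (simp add: iter_def k nat_add_distrib)
  ultimately show ?thesis using \<open>bij f\<close> by (simp add: bij_is_surj surj_f_inv_f)
qed


section \<open>Eigenlines, and the lifts of homoclinic points to them\<close>

locale hyperbolic_matrix =
  fixes M :: "int^2^2"
  assumes invertible: "invertible M" and hyperbolic: "hyperbolic M" and trace_pos: "trace M > 0"
begin

abbreviation A :: "real^2^2" where "A \<equiv> real_mat M"
abbreviation \<Lambda> :: real where "\<Lambda> \<equiv> lam M"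

text \<open>An inverse over the integers, so that backward orbits of lattice vectors stay in the
  lattice.\<close>

definition Minv :: "int^2^2" where "Minv = (SOME M'. M ** M' = mat 1 \<and> M' ** M = mat 1)"
abbreviation B :: "real^2^2" where "B \<equiv> real_mat Minv"

text \<open>The second eigenvalue, as the trace is the sum of both. It equals
  \<open>det M / \<Lambda>\<close>, so it is negative for determinant -1.\<close>

definition \<mu> :: real where "\<mu> = of_int (trace M) - \<Lambda>"

lemma Minv: "M ** Minv = mat 1" "Minv ** M = mat 1"
  using someI_ex[OF invertible[unfolded invertible_def]] by (auto simp: Minv_def)

lemma det_cases: "det M = -1 \<and> trace M \<ge> 1 \<or> det M = 1 \<and> trace M \<ge> 3"
  using hyperbolic hyperbolic_iff[OF invertible trace_pos] by blast

lemma real_mat_mult: "real_mat (P ** Q) = real_mat P ** real_mat Q"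
  by (simp add: real_mat_def matrix_matrix_mult_def vec_eq_iff)

lemma real_mat_1: "real_mat (mat 1) = mat 1"
  by (simp add: real_mat_def mat_def vec_eq_iff)

lemma A_B: "A *v (B *v v) = v" "B *v (A *v v) = v"
  by (simp_all add: matrix_vector_mul_assoc real_mat_mult[symmetric] Minv real_mat_1)

lemma lam_mult_mu: "\<Lambda> * \<mu> = of_int (det M)"
proof -
  let ?r = "real_of_int (trace M)"
  have "0 \<le> discr M"
  proof (cases "det M = 1")
    case True
    then have "trace M \<ge> 3" using det_cases by auto
    then have "(trace M)\<^sup>2 \<ge> 3\<^sup>2" by (intro power_mono) auto
    then show ?thesis using True by (simp add: discr_def)
  qed (use det_cases in \<open>auto simp: discr_def\<close>)
  then have "(sqrt (of_int (discr M)))\<^sup>2 = real_of_int (discr M)" by simp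
  then have "(sqrt (of_int (discr M)))\<^sup>2 = ?r\<^sup>2 - 4 * of_int (det M)" by (simp add: discr_def)
  then show ?thesis by (simp add: \<mu>_def lam_def power2_eq_square field_simps)
qed

lemma lam_sq: "\<Lambda> * \<Lambda> = of_int (trace M) * \<Lambda> - of_int (det M)"
  using lam_mult_mu by (simp add: \<mu>_def algebra_simps)

lemma lam_gt_1: "1 < \<Lambda>"
proof -
  have "discr M > 1 \<or> trace M \<ge> 2 \<and> discr M \<ge> 1"
    using det_cases
  proof
    assume *: "det M = 1 \<and> trace M \<ge> 3"
    then have "(trace M)\<^sup>2 \<ge> 3\<^sup>2" by (intro power_mono) auto
    then show ?thesis using * by (simp add: discr_def)
  next
    assume *: "det M = -1 \<and> trace M \<ge> 1"
    then show ?thesis using zero_le_power2[of "trace M"] unfolding discr_def by linarith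
  qed
  then show ?thesis
  proof
    assume "discr M > 1"
    then have "sqrt (of_int (discr M)) > 1" by simp
    moreover have "real_of_int (trace M) \<ge> 1" using trace_pos by simp
    ultimately have "1 + 1 < real_of_int (trace M) + sqrt (of_int (discr M))"
      by (rule add_le_less_mono[rotated])
    then show ?thesis by (simp add: lam_def)
  next
    assume "trace M \<ge> 2 \<and> discr M \<ge> 1"
    then have "sqrt (of_int (discr M)) \<ge> 1" "real_of_int (trace M) \<ge> 2" by simp_all
    then have "2 + 1 \<le> real_of_int (trace M) + sqrt (of_int (discr M))"
      by (rule add_mono[rotated])
    then show ?thesis by (simp add: lam_def)
  qed
qed

lemma lam_pos [simp]: "0 < \<Lambda>" "0 \<le> \<Lambda>" "\<Lambda> \<noteq> 0" using lam_gt_1 by auto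

lemma abs_mu: "\<bar>\<mu>\<bar> = 1 / \<Lambda>"
proof -
  have "\<Lambda> * \<bar>\<mu>\<bar> = 1" using arg_cong[OF lam_mult_mu, of abs] det_cases by (auto simp: abs_mult)
  then show ?thesis by (simp add: field_simps)
qed

lemma mu_nonzero [simp]: "\<mu> \<noteq> 0" using abs_mu by auto

lemma cayley_hamilton: "A *v (A *v v) = of_int (trace M) *\<^sub>R (A *v v) - of_int (det M) *\<^sub>R v"
  by (simp add: vec_eq_iff forall_2 matrix_vector_mult_def sum_2 real_mat_def trace_def det_2
      algebra_simps)

lemma eigen_B: "A *v v = c *\<^sub>R v \<Longrightarrow> c \<noteq> 0 \<Longrightarrow> B *v v = (1 / c) *\<^sub>R v"
proof -
  assume v: "A *v v = c *\<^sub>R v" "c \<noteq> 0"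
  have "v = c *\<^sub>R (B *v v)"
    using A_B(2)[of v] by (simp add: v(1) matrix_vector_mult_scaleR)
  then have "(1 / c) *\<^sub>R v = (1 / c) *\<^sub>R (c *\<^sub>R (B *v v))" by simp
  then show ?thesis using v(2) by simp
qed

text \<open>Cayley-Hamilton in the form \<open>(A - \<Lambda>) (A - \<mu>) = 0\<close>: applying
  \<open>A - \<mu>\<close> isolates the expanding part of \<open>v\<close> without a choice of
  eigenvectors.\<close>

lemma stable_component: "A *v (A *v v - \<mu> *\<^sub>R v) = \<Lambda> *\<^sub>R (A *v v - \<mu> *\<^sub>R v)"
proof -
  have "A *v (A *v v - \<mu> *\<^sub>R v)
      = of_int (trace M) *\<^sub>R (A *v v) - of_int (det M) *\<^sub>R v - \<mu> *\<^sub>R (A *v v)"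
    by (simp add: matrix_vector_mult_diff_distrib cayley_hamilton matrix_vector_mult_scaleR)
  also have "\<dots> = \<Lambda> *\<^sub>R (A *v v) - (\<Lambda> * \<mu>) *\<^sub>R v"
    unfolding lam_mult_mu by (simp add: \<mu>_def algebra_simps)
  finally show ?thesis by (simp add: algebra_simps)
qed

lemma unstable_component: "A *v (A *v v - \<Lambda> *\<^sub>R v) = \<mu> *\<^sub>R (A *v v - \<Lambda> *\<^sub>R v)"
proof -
  have "A *v (A *v v - \<Lambda> *\<^sub>R v)
      = of_int (trace M) *\<^sub>R (A *v v) - of_int (det M) *\<^sub>R v - \<Lambda> *\<^sub>R (A *v v)"
    by (simp add: matrix_vector_mult_diff_distrib cayley_hamilton matrix_vector_mult_scaleR)
  also have "\<dots> = \<mu> *\<^sub>R (A *v v) - (\<Lambda> * \<mu>) *\<^sub>R v"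
    unfolding lam_mult_mu by (simp add: \<mu>_def algebra_simps)
  finally show ?thesis by (simp add: algebra_simps)
qed

lemma no_expansion:
  fixes z :: "real^2"
  assumes "(\<lambda>n. c ^ n *\<^sub>R z) \<longlonglongrightarrow> 0" "\<bar>c\<bar> \<ge> 1"
  shows "z = 0"
proof (rule ccontr)
  assume "z \<noteq> 0"
  then have "\<forall>\<^sub>F n in sequentially. norm (c ^ n *\<^sub>R z) < norm z"
    using tendstoD[OF assms(1), of "norm z"] by (simp add: dist_norm)
  then obtain n where "norm (c ^ n *\<^sub>R z) < norm z" by (auto simp: eventually_sequentially)
  moreover have "1 * norm z \<le> \<bar>c\<bar> ^ n * norm z"
    using assms(2) by (intro mult_right_mono) (auto simp: one_le_power)
  ultimately show False by (simp add: power_abs)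
qed

text \<open>\<open>A - \<mu>\<close> commutes with \<open>A\<close>, so the expanding part of
  \<open>u\<close> also tends to zero under iteration, although each step multiplies it by
  \<open>\<Lambda> > 1\<close>. It must vanish.\<close>

lemma contracted_forward:
  assumes "(\<lambda>n. ((*v) A ^^ n) u) \<longlonglongrightarrow> 0"
  shows "A *v u = \<mu> *\<^sub>R u"
proof -
  have "(\<lambda>n. ((*v) A ^^ n) (A *v u - \<mu> *\<^sub>R u)) \<longlonglongrightarrow> A *v 0 - \<mu> *\<^sub>R 0"
  proof (rule Lim_transform_eventually)
    show "(\<lambda>n. A *v (((*v) A ^^ n) u) - \<mu> *\<^sub>R (((*v) A ^^ n) u)) \<longlonglongrightarrow> A *v 0 - \<mu> *\<^sub>R 0"
      by (intro tendsto_intros assms bounded_linear.tendsto[OF matrix_vector_mul_bounded_linear])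
    have "((*v) A ^^ n) (A *v u - \<mu> *\<^sub>R u) = A *v (((*v) A ^^ n) u) - \<mu> *\<^sub>R (((*v) A ^^ n) u)" for n
      by (induction n) (simp_all add: matrix_vector_mult_diff_distrib matrix_vector_mult_scaleR)
    then show "\<forall>\<^sub>F n in sequentially. A *v (((*v) A ^^ n) u) - \<mu> *\<^sub>R (((*v) A ^^ n) u)
        = ((*v) A ^^ n) (A *v u - \<mu> *\<^sub>R u)" by simp
  qed
  then have "(\<lambda>n. \<Lambda> ^ n *\<^sub>R (A *v u - \<mu> *\<^sub>R u)) \<longlonglongrightarrow> 0"
    by (simp add: funpow_eigen[OF stable_component])
  from no_expansion[OF this] show ?thesis using lam_gt_1 by simp
qed

lemma contracted_backward:
  assumes "(\<lambda>n. ((*v) B ^^ n) u) \<longlonglongrightarrow> 0"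
  shows "A *v u = \<Lambda> *\<^sub>R u"
proof -
  have "(\<lambda>n. ((*v) B ^^ n) (A *v u - \<Lambda> *\<^sub>R u)) \<longlonglongrightarrow> A *v 0 - \<Lambda> *\<^sub>R 0"
  proof (rule Lim_transform_eventually)
    show "(\<lambda>n. A *v (((*v) B ^^ n) u) - \<Lambda> *\<^sub>R (((*v) B ^^ n) u)) \<longlonglongrightarrow> A *v 0 - \<Lambda> *\<^sub>R 0"
      by (intro tendsto_intros assms bounded_linear.tendsto[OF matrix_vector_mul_bounded_linear])
    have "((*v) B ^^ n) (A *v u - \<Lambda> *\<^sub>R u) = A *v (((*v) B ^^ n) u) - \<Lambda> *\<^sub>R (((*v) B ^^ n) u)" for n
      by (induction n) (simp_all add: matrix_vector_mult_diff_distrib matrix_vector_mult_scaleR A_B)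
    then show "\<forall>\<^sub>F n in sequentially. A *v (((*v) B ^^ n) u) - \<Lambda> *\<^sub>R (((*v) B ^^ n) u)
        = ((*v) B ^^ n) (A *v u - \<Lambda> *\<^sub>R u)" by simp
  qed
  then have "(\<lambda>n. (1 / \<mu>) ^ n *\<^sub>R (A *v u - \<Lambda> *\<^sub>R u)) \<longlonglongrightarrow> 0"
    by (simp add: funpow_eigen[OF eigen_B[OF unstable_component]])
  from no_expansion[OF this] show ?thesis using lam_gt_1 by (simp add: abs_mu)
qed

text \<open>Powers of \<open>B\<close> keep \<open>p\<close> integral while shrinking it
  geometrically, eventually below length 1. This irrationality of the eigenline yields unique lifts
  of homoclinic points and injectivity on finite sequences.\<close>

lemma eigen_lattice_zero:
  assumes "p \<in> lattice" "A *v p = \<Lambda> *\<^sub>R p"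
  shows "p = 0"
proof -
  have "(\<lambda>n. (1 / \<Lambda>) ^ n *\<^sub>R p) \<longlonglongrightarrow> 0 *\<^sub>R p"
    using lam_gt_1 by (intro tendsto_intros LIMSEQ_power_zero) simp
  then have "\<forall>\<^sub>F n in sequentially. norm ((1 / \<Lambda>) ^ n *\<^sub>R p) < 1"
    by (auto simp: tendsto_iff dist_norm)
  then obtain n where n: "norm ((1 / \<Lambda>) ^ n *\<^sub>R p) < 1" by (auto simp: eventually_sequentially)
  have "((*v) B ^^ n) p \<in> lattice" for n
    using assms(1) by (induction n) (auto intro: lattice_real_mat)
  then have "(1 / \<Lambda>) ^ n *\<^sub>R p \<in> lattice"
    by (simp add: funpow_eigen[OF eigen_B[OF assms(2)], symmetric])
  from lattice_small[OF this n] show ?thesis by simp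
qed

lemma inv_A: "inv ((*v) A) = (*v) B"
  by (rule inv_unique_comp) (auto simp: A_B fun_eq_iff)

lemma torus_aut_inverse:
  "torus_aut M (torus_aut Minv x) = x" "torus_aut Minv (torus_aut M x) = x"
proof -
  obtain v where "x = to_torus v" using to_torus_surj by metis
  then show "torus_aut M (torus_aut Minv x) = x" "torus_aut Minv (torus_aut M x) = x"
    by (simp_all add: torus_aut_to_torus A_B)
qed

lemma bij_torus_aut: "bij (torus_aut M)" and inv_torus_aut: "inv (torus_aut M) = torus_aut Minv"
proof -
  show "bij (torus_aut M)" by (rule o_bij[of "torus_aut Minv"]) (auto simp: torus_aut_inverse fun_eq_iff)
  show "inv (torus_aut M) = torus_aut Minv"
    by (rule inv_unique_comp) (auto simp: torus_aut_inverse fun_eq_iff)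
qed

lemma iter_torus_aut:
  "iter (torus_aut M) (int n) (to_torus v) = to_torus (((*v) A ^^ n) v)"
  "iter (torus_aut M) (- int n) (to_torus v) = to_torus (((*v) B ^^ n) v)"
proof -
  have *: "(torus_aut P ^^ n) (to_torus v) = to_torus (((*v) (real_mat P) ^^ n) v)" for P
    by (induction n) (simp_all add: torus_aut_to_torus)
  show "iter (torus_aut M) (int n) (to_torus v) = to_torus (((*v) A ^^ n) v)"
    by (simp add: iter_def *)
  show "iter (torus_aut M) (- int n) (to_torus v) = to_torus (((*v) B ^^ n) v)"
    by (cases "n = 0") (simp_all add: iter_def * inv_torus_aut)
qed

lemma iter_eigen:
  assumes "A *v t = \<Lambda> *\<^sub>R t"
  shows "iter ((*v) A) (- n) t = (\<Lambda> powi (- n)) *\<^sub>R t"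
proof (cases "n \<le> 0")
  case True
  then show ?thesis by (simp add: iter_def funpow_eigen[OF assms] power_int_def)
next
  case False
  then show ?thesis
    by (simp add: iter_def inv_A funpow_eigen[OF eigen_B[OF assms]] power_int_def inverse_eq_divide)
qed

lemma funpow_lattice: "p \<in> lattice \<Longrightarrow> ((*v) (real_mat P) ^^ n) p \<in> lattice"
  by (induction n) (auto intro: lattice_real_mat)

lemma funpow_diff: "((*v) (P::real^2^2) ^^ n) (u - v) = ((*v) P ^^ n) u - ((*v) P ^^ n) v"
  by (induction n) (simp_all add: matrix_vector_mult_diff_distrib)

lemma funpow_A_B: "((*v) B ^^ n) (((*v) A ^^ n) v) = v" "((*v) A ^^ n) (((*v) B ^^ n) v) = v"
proof -
  have *: "((*v) P ^^ n) (((*v) Q ^^ n) v) = v" if "\<And>v. P *v (Q *v v) = v" for P Q :: "real^2^2"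
  proof (induction n)
    case (Suc n)
    have "((*v) P ^^ Suc n) (((*v) Q ^^ Suc n) v) = ((*v) P ^^ n) (P *v (Q *v (((*v) Q ^^ n) v)))"
      by (simp add: funpow_swap1)
    then show ?case using Suc that by simp
  qed simp
  show "((*v) B ^^ n) (((*v) A ^^ n) v) = v" "((*v) A ^^ n) (((*v) B ^^ n) v) = v"
    using * A_B by auto
qed

text \<open>The orbit is known to contract in the plane only from time \<open>N\<close> on;
  \<open>B ^ N\<close> preserves both the eigenline and the lattice and carries the decomposition
  back to time 0.\<close>

lemma homoclinic_stable:
  assumes "homoclinic M (to_torus v)"
  obtains p where "p \<in> lattice" "A *v (v - p) = \<mu> *\<^sub>R (v - p)"
proof -
  have "(\<lambda>n. to_torus (((*v) A ^^ n) v)) \<longlonglongrightarrow> 0"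
    using assms by (simp add: homoclinic_def iter_torus_aut)
  from torus_orbit_tendsto_zero[OF lattice_real_mat this] obtain N p where p: "p \<in> lattice"
    "(\<lambda>n. ((*v) A ^^ n) (((*v) A ^^ N) v - p)) \<longlonglongrightarrow> 0" by blast
  define u where "u = ((*v) A ^^ N) v - p"
  have "B *v u = (1 / \<mu>) *\<^sub>R u"
    using contracted_forward[OF p(2)] by (simp add: u_def eigen_B)
  then have "((*v) B ^^ N) u = (1 / \<mu>) ^ N *\<^sub>R u" by (rule funpow_eigen)
  moreover have "((*v) B ^^ N) u = v - ((*v) B ^^ N) p" by (simp add: u_def funpow_diff funpow_A_B)
  ultimately have "v - ((*v) B ^^ N) p = (1 / \<mu>) ^ N *\<^sub>R u" by simp
  then have "A *v (v - ((*v) B ^^ N) p) = \<mu> *\<^sub>R (v - ((*v) B ^^ N) p)"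
    using contracted_forward[OF p(2)] by (simp add: u_def[symmetric] matrix_vector_mult_scaleR)
  then show ?thesis using that funpow_lattice[OF p(1)] by blast
qed

lemma homoclinic_unstable:
  assumes "homoclinic M (to_torus v)"
  obtains p where "p \<in> lattice" "A *v (v - p) = \<Lambda> *\<^sub>R (v - p)"
proof -
  have "(\<lambda>n. to_torus (((*v) B ^^ n) v)) \<longlonglongrightarrow> 0"
    using assms by (simp add: homoclinic_def iter_torus_aut)
  from torus_orbit_tendsto_zero[OF lattice_real_mat this] obtain N p where p: "p \<in> lattice"
    "(\<lambda>n. ((*v) B ^^ n) (((*v) B ^^ N) v - p)) \<longlonglongrightarrow> 0" by blast
  define u where "u = ((*v) B ^^ N) v - p"
  have u: "A *v u = \<Lambda> *\<^sub>R u" using contracted_backward[OF p(2)] by (simp add: u_def)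
  then have "((*v) A ^^ N) u = \<Lambda> ^ N *\<^sub>R u" by (rule funpow_eigen)
  moreover have "((*v) A ^^ N) u = v - ((*v) A ^^ N) p" by (simp add: u_def funpow_diff funpow_A_B)
  ultimately have "v - ((*v) A ^^ N) p = \<Lambda> ^ N *\<^sub>R u" by simp
  then have "A *v (v - ((*v) A ^^ N) p) = \<Lambda> *\<^sub>R (v - ((*v) A ^^ N) p)"
    using u by (simp add: matrix_vector_mult_scaleR)
  then show ?thesis using that funpow_lattice[OF p(1)] by blast
qed

lemma bij_betw_homoclinic_coords: "bij_betw to_torus (homoclinic_coords M) {x. homoclinic M x}"
proof (rule bij_betwI')
  fix t t' assume t: "t \<in> homoclinic_coords M" "t' \<in> homoclinic_coords M"
  have "t - t' = 0" if "to_torus t = to_torus t'"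
  proof (rule eigen_lattice_zero)
    show "t - t' \<in> lattice" using that by (simp add: to_torus_eq_lattice)
    show "A *v (t - t') = \<Lambda> *\<^sub>R (t - t')"
      using t by (simp add: homoclinic_coords_def matrix_vector_mult_diff_distrib algebra_simps)
  qed
  then show "to_torus t = to_torus t' \<longleftrightarrow> t = t'" by auto
next
  fix x assume x: "x \<in> {x. homoclinic M x}"
  obtain v where v: "x = to_torus v" using to_torus_surj by blast
  obtain p where p: "p \<in> lattice" "A *v (v - p) = \<Lambda> *\<^sub>R (v - p)"
    using homoclinic_unstable x v by auto
  have "to_torus (v - p) = x" using p(1) v by (simp add: to_torus_eq_lattice lattice_def)
  then show "\<exists>t\<in>homoclinic_coords M. x = to_torus t"
    using p(2) x by (intro bexI[of _ "v - p"]) (auto simp: homoclinic_coords_def)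
qed (simp add: homoclinic_coords_def)

end


subsection \<open>Coding maps\<close>

lemma tendsto_fun_eventually_eq:
  fixes l :: "'a \<Rightarrow> 'b::topological_space"
  assumes "\<And>i. \<forall>\<^sub>F n in F. f n i = l i"
  shows "(f \<longlongrightarrow> l) F"
proof -
  have "limitin (product_topology (\<lambda>_. euclidean) UNIV) f l F"
    unfolding limitin_componentwise using tendsto_eventually[OF assms] by auto
  then show ?thesis by (simp add: euclidean_product_topology)
qed

lemma sum_int_split:
  fixes f :: "int \<Rightarrow> 'a::comm_monoid_add"
  shows "(\<Sum>n = - int K..int N. f n) = (\<Sum>n<Suc N. f (int n)) + (\<Sum>k<K. f (- int (Suc k)))"
proof (induction K)
  case 0
  have "{0..int N} = int ` {..<Suc N}" by (auto simp: image_iff intro!: bexI[of _ "nat x" for x])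
  then show ?case by (simp add: sum.reindex del: lessThan_Suc sum.lessThan_Suc)
next
  case (Suc K)
  have "{- int (Suc K)..int N} = insert (- int (Suc K)) {- int K..int N}" by auto
  then show ?case using Suc by (simp add: add_ac)
qed

definition unit_seq :: "int \<Rightarrow> int \<Rightarrow> nat" where
  "unit_seq m = (\<lambda>n. if n = m then 1 else 0)"

definition truncate :: "nat \<Rightarrow> (int \<Rightarrow> nat) \<Rightarrow> int \<Rightarrow> nat" where
  "truncate K \<epsilon> = (\<lambda>n. if \<bar>n\<bar> \<le> int K then \<epsilon> n else 0)"

lemma shift_unit_seq: "shift (unit_seq (m + 1)) = unit_seq m"
  by (auto simp: shift_def unit_seq_def)

lemma truncate_finite: "truncate K \<epsilon> \<in> finite_seqs"
proof -
  have "{n. truncate K \<epsilon> n \<noteq> 0} \<subseteq> {- int K..int K}" by (auto simp: truncate_def)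
  then show ?thesis unfolding finite_seqs_def using finite_subset by blast
qed

lemma truncate_le: "truncate K \<epsilon> n \<le> \<epsilon> n"
  by (simp add: truncate_def)

lemma truncate_tendsto: "(\<lambda>K. truncate K \<epsilon>) \<longlonglongrightarrow> \<epsilon>"
proof (rule tendsto_fun_eventually_eq)
  fix i
  show "\<forall>\<^sub>F K in sequentially. truncate K \<epsilon> i = \<epsilon> i"
    using eventually_ge_at_top[of "nat \<bar>i\<bar>"] by eventually_elim (auto simp: truncate_def)
qed

context hyperbolic_matrix
begin

lemma inverse_lam_summable: "summable (\<lambda>n. (1 / \<Lambda>) ^ n)"
  using lam_gt_1 by (intro summable_geometric) simp

lemma Xtilde_alt: "\<epsilon> \<in> Xtilde M \<longleftrightarrow>
    summable (\<lambda>n. real (\<epsilon> (int n)) / \<Lambda> ^ n) \<and> summable (\<lambda>k. real (\<epsilon> (- int (Suc k))) * \<bar>\<mu>\<bar> ^ Suc k)"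
proof -
  have "summable (\<lambda>k. real (\<epsilon> (int (Suc k))) / \<Lambda> ^ Suc k) \<longleftrightarrow> summable (\<lambda>n. real (\<epsilon> (int n)) / \<Lambda> ^ n)"
    by (rule summable_Suc_iff)
  moreover have "real (\<epsilon> (- int (Suc k))) / \<Lambda> ^ Suc k = real (\<epsilon> (- int (Suc k))) * \<bar>\<mu>\<bar> ^ Suc k" for k
    by (simp only: abs_mu power_one_over times_divide_eq_right mult_1_right)
  ultimately show ?thesis unfolding Xtilde_def by simp
qed

lemma bounded_in_Xtilde:
  assumes "\<And>n. \<epsilon> n \<le> b"
  shows "\<epsilon> \<in> Xtilde M"
proof -
  have 1: "summable (\<lambda>n. real b * (1 / \<Lambda>) ^ n)" by (intro summable_mult inverse_lam_summable)
  have 2: "summable (\<lambda>n. real b * (1 / \<Lambda>) ^ Suc n)" by (subst summable_Suc_iff) (rule 1)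
  show ?thesis unfolding Xtilde_alt
  proof
    show "summable (\<lambda>n. real (\<epsilon> (int n)) / \<Lambda> ^ n)"
      by (rule summable_comparison_test'[OF 1])
        (use assms in \<open>auto simp: power_one_over divide_simps\<close>)
    show "summable (\<lambda>k. real (\<epsilon> (- int (Suc k))) * \<bar>\<mu>\<bar> ^ Suc k)"
      by (rule summable_comparison_test'[OF 2])
        (use assms in \<open>auto simp: abs_mu abs_mult power_abs simp del: of_nat_Suc power_Suc intro!: mult_right_mono\<close>)
  qed
qed

lemma dominated_in_Xtilde:
  assumes "\<delta> \<in> Xtilde M" "\<And>n. \<epsilon> n \<le> \<delta> n"
  shows "\<epsilon> \<in> Xtilde M"
  unfolding Xtilde_alt
proof
  show "summable (\<lambda>n. real (\<epsilon> (int n)) / \<Lambda> ^ n)"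
    by (rule summable_comparison_test'[OF conjunct1[OF assms(1)[unfolded Xtilde_alt]]])
      (use assms(2) in \<open>auto intro!: divide_right_mono\<close>)
  show "summable (\<lambda>k. real (\<epsilon> (- int (Suc k))) * \<bar>\<mu>\<bar> ^ Suc k)"
    by (rule summable_comparison_test'[OF conjunct2[OF assms(1)[unfolded Xtilde_alt]]])
      (use assms(2) in \<open>auto simp: abs_mult simp del: of_nat_Suc power_Suc intro!: mult_right_mono\<close>)
qed

lemma Xtilde_add:
  assumes "\<epsilon> \<in> Xtilde M" "\<epsilon>' \<in> Xtilde M"
  shows "(\<lambda>n. \<epsilon> n + \<epsilon>' n) \<in> Xtilde M"
proof -
  have "summable (\<lambda>n. real (\<epsilon> (int n)) / \<Lambda> ^ n + real (\<epsilon>' (int n)) / \<Lambda> ^ n)"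
    "summable (\<lambda>k. real (\<epsilon> (- int (Suc k))) * \<bar>\<mu>\<bar> ^ Suc k + real (\<epsilon>' (- int (Suc k))) * \<bar>\<mu>\<bar> ^ Suc k)"
    using assms unfolding Xtilde_alt by (auto intro: summable_add)
  then show ?thesis unfolding Xtilde_alt by (simp add: add_divide_distrib distrib_right)
qed

section \<open>The coding map of a homoclinic point\<close>

definition stable :: "real^2 \<Rightarrow> real^2" where
  "stable t = (SOME s. A *v s = \<mu> *\<^sub>R s \<and> t - s \<in> lattice)"

definition future :: "(int \<Rightarrow> nat) \<Rightarrow> real" where
  "future \<epsilon> = (\<Sum>n. real (\<epsilon> (int n)) / \<Lambda> ^ n)"

definition past :: "(int \<Rightarrow> nat) \<Rightarrow> real" where
  "past \<epsilon> = (\<Sum>k. real (\<epsilon> (- int (Suc k))) * \<mu> ^ Suc k)"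

text \<open>Modulo the lattice the divergent powers of \<^term>\<open>\<Lambda>\<close> at \<open>t\<close> agree with powers of the
  conjugate eigenvalue at \<^term>\<open>stable t\<close>, which makes the past converge.\<close>

definition planar :: "real^2 \<Rightarrow> (int \<Rightarrow> nat) \<Rightarrow> real^2" where
  "planar t \<epsilon> = future \<epsilon> *\<^sub>R t + past \<epsilon> *\<^sub>R stable t"

lemma stable:
  assumes "t \<in> homoclinic_coords M"
  shows "A *v stable t = \<mu> *\<^sub>R stable t" "t - stable t \<in> lattice"
proof -
  obtain p where "p \<in> lattice" "A *v (t - p) = \<mu> *\<^sub>R (t - p)"
    using homoclinic_stable assms unfolding homoclinic_coords_def by blast
  then have "A *v (t - p) = \<mu> *\<^sub>R (t - p) \<and> t - (t - p) \<in> lattice" by simp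
  from someI[of "\<lambda>s. A *v s = \<mu> *\<^sub>R s \<and> t - s \<in> lattice", OF this]
  show "A *v stable t = \<mu> *\<^sub>R stable t" "t - stable t \<in> lattice" by (auto simp: stable_def)
qed

lemma homoclinic_eigen: "t \<in> homoclinic_coords M \<Longrightarrow> A *v t = \<Lambda> *\<^sub>R t"
  by (simp add: homoclinic_coords_def)

lemma power_lattice:
  assumes "t \<in> homoclinic_coords M"
  shows "\<Lambda> ^ n *\<^sub>R t - \<mu> ^ n *\<^sub>R stable t \<in> lattice"
  using funpow_lattice[OF stable(2)[OF assms], of n M]
  by (simp add: funpow_diff funpow_eigen[OF homoclinic_eigen[OF assms]] funpow_eigen[OF stable(1)[OF assms]])

lemma summable_future: "\<epsilon> \<in> Xtilde M \<Longrightarrow> summable (\<lambda>n. real (\<epsilon> (int n)) / \<Lambda> ^ n)"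
  by (simp add: Xtilde_alt)

lemma summable_past: "\<epsilon> \<in> Xtilde M \<Longrightarrow> summable (\<lambda>k. real (\<epsilon> (- int (Suc k))) * \<mu> ^ Suc k)"
proof -
  assume "\<epsilon> \<in> Xtilde M"
  then have "summable (\<lambda>k. real (\<epsilon> (- int (Suc k))) * \<bar>\<mu>\<bar> ^ Suc k)" by (simp add: Xtilde_alt)
  then have "summable (\<lambda>k. norm (real (\<epsilon> (- int (Suc k))) * \<mu> ^ Suc k))"
    by (simp add: abs_mult power_abs)
  then show ?thesis by (rule summable_norm_cancel)
qed

text \<open>Digits are integers, so exchanging \<open>\<Lambda> ^ Suc k *\<^sub>R t\<close> for
  \<open>\<mu> ^ Suc k *\<^sub>R stable t\<close> at the negative places changes the sum by a
  lattice vector only.\<close>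

lemma to_torus_partial_sum:
  assumes t: "t \<in> homoclinic_coords M"
  shows "to_torus ((\<Sum>n = - int K..int N. real (\<epsilon> n) * \<Lambda> powi (- n)) *\<^sub>R t)
    = to_torus ((\<Sum>n<Suc N. real (\<epsilon> (int n)) / \<Lambda> ^ n) *\<^sub>R t
        + (\<Sum>k<K. real (\<epsilon> (- int (Suc k))) * \<mu> ^ Suc k) *\<^sub>R stable t)"
proof -
  have pos: "real (\<epsilon> (int n)) * \<Lambda> powi (- int n) = real (\<epsilon> (int n)) / \<Lambda> ^ n" for n
    by (simp add: power_int_minus divide_inverse)
  have neg: "real (\<epsilon> (- int (Suc k))) * \<Lambda> powi (- (- int (Suc k))) = real (\<epsilon> (- int (Suc k))) * \<Lambda> ^ Suc k" for k
    by (simp only: minus_minus power_int_of_nat)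
  have "(\<Sum>k<K. real (\<epsilon> (- int (Suc k))) *\<^sub>R (\<Lambda> ^ Suc k *\<^sub>R t - \<mu> ^ Suc k *\<^sub>R stable t)) \<in> lattice"
    by (intro lattice_sum lattice_scaleR_nat power_lattice t)
  then show ?thesis
    unfolding to_torus_eq_lattice sum_int_split pos neg
    by (simp add: algebra_simps scaleR_sum_left sum_subtractf scaleR_diff_right del: power_Suc sum.lessThan_Suc of_nat_Suc)
qed

text \<open>After the exchange, past and future converge separately, so the two cut-offs may tend to
  infinity independently. The symmetric limit defining \<open>phi\<close> is the diagonal.\<close>

lemma phi_limits:
  assumes t: "t \<in> homoclinic_coords M" and e: "\<epsilon> \<in> Xtilde M"
  shows "((\<lambda>(K, N). to_torus ((\<Sum>n = - int K..int N. real (\<epsilon> n) * \<Lambda> powi (- n)) *\<^sub>R t))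
      \<longlongrightarrow> to_torus (planar t \<epsilon>)) (sequentially \<times>\<^sub>F sequentially)" (is ?two)
    and "(\<lambda>N. to_torus (\<Sum>n = - int N..int N. real (\<epsilon> n) *\<^sub>R iter ((*v) A) (- n) t))
      \<longlonglongrightarrow> to_torus (planar t \<epsilon>)" (is ?one)
    and "phi M t \<epsilon> = to_torus (planar t \<epsilon>)" (is ?eq)
proof -
  have fut: "(\<lambda>N. \<Sum>n<Suc N. real (\<epsilon> (int n)) / \<Lambda> ^ n) \<longlonglongrightarrow> future \<epsilon>"
    using summable_LIMSEQ[OF summable_future[OF e]] unfolding future_def by (rule LIMSEQ_Suc)
  have past: "(\<lambda>K. \<Sum>k<K. real (\<epsilon> (- int (Suc k))) * \<mu> ^ Suc k) \<longlonglongrightarrow> past \<epsilon>"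
    using summable_LIMSEQ[OF summable_past[OF e]] unfolding past_def .
  show two: ?two
    unfolding to_torus_partial_sum[OF t] case_prod_unfold planar_def
    by (intro tendsto_to_torus tendsto_add tendsto_scaleR tendsto_const
      filterlim_compose[OF fut filterlim_snd] filterlim_compose[OF past filterlim_fst])
  have "filterlim (\<lambda>N. (N, N)) (sequentially \<times>\<^sub>F sequentially) sequentially"
    by (intro filterlim_Pair filterlim_ident)
  from filterlim_compose[OF two this] show one: ?one
    by (simp add: iter_eigen[OF homoclinic_eigen[OF t]] scaleR_sum_left)
  show ?eq using e limI[OF one] by (simp add: phi_def)
qed

text \<open>The shift moves digit 0 from the series along \<open>t\<close> to the series along
  \<open>stable t\<close>. This is the only discrepancy, and it is an integer multiple of the
  lattice vector \<open>\<Lambda> t - \<mu> stable t\<close>.\<close>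

lemma planar_shift:
  assumes t: "t \<in> homoclinic_coords M" and e: "\<epsilon> \<in> Xtilde M"
  shows "A *v planar t \<epsilon> - planar t (shift \<epsilon>) \<in> lattice"
proof -
  have "future (shift \<epsilon>) = (\<Sum>n. \<Lambda> * (real (\<epsilon> (int (Suc n))) / \<Lambda> ^ Suc n))"
    unfolding future_def shift_def by (simp add: add.commute)
  also have "\<dots> = \<Lambda> * (\<Sum>n. real (\<epsilon> (int (Suc n))) / \<Lambda> ^ Suc n)"
    by (rule suminf_mult) (use summable_future[OF e] in \<open>simp only: summable_Suc_iff[of "\<lambda>n. real (\<epsilon> (int n)) / \<Lambda> ^ n"]\<close>)
  also have "\<dots> = \<Lambda> * (future \<epsilon> - real (\<epsilon> 0))"
    using suminf_split_head[OF summable_future[OF e]] by (simp add: future_def)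
  finally have fut: "future (shift \<epsilon>) = \<Lambda> * (future \<epsilon> - real (\<epsilon> 0))" .
  define g where "g k = real (shift \<epsilon> (- int (Suc k))) * \<mu> ^ Suc k" for k
  have gS: "g (Suc k) = \<mu> * (real (\<epsilon> (- int (Suc k))) * \<mu> ^ Suc k)" for k
    by (simp add: g_def shift_def)
  have "summable (\<lambda>k. g (Suc k))"
    unfolding gS by (intro summable_mult summable_past e)
  then have "summable g" by (simp only: summable_Suc_iff)
  then have "past (shift \<epsilon>) = (\<Sum>k. g (Suc k)) + g 0"
    using suminf_split_head[of g] by (simp add: past_def g_def[abs_def])
  also have "(\<Sum>k. g (Suc k)) = \<mu> * past \<epsilon>"
    unfolding gS past_def by (rule suminf_mult) (rule summable_past[OF e])
  also have "g 0 = \<mu> * real (\<epsilon> 0)" by (simp add: g_def shift_def)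
  finally have past: "past (shift \<epsilon>) = \<mu> * past \<epsilon> + \<mu> * real (\<epsilon> 0)" .
  have "A *v planar t \<epsilon> - planar t (shift \<epsilon>) = real (\<epsilon> 0) *\<^sub>R (\<Lambda> ^ 1 *\<^sub>R t - \<mu> ^ 1 *\<^sub>R stable t)"
    by (simp add: planar_def fut past matrix_vector_right_distrib matrix_vector_mult_scaleR
      homoclinic_eigen[OF t] stable(1)[OF t] algebra_simps)
  then show ?thesis using lattice_scaleR_nat[OF power_lattice[OF t]] by metis
qed

lemma continuous_on_digit: "continuous_on S (\<lambda>\<epsilon> :: int \<Rightarrow> nat. real (\<epsilon> i) * c)"
proof -
  have "continuous_on UNIV (\<lambda>\<epsilon> :: int \<Rightarrow> nat. real (\<epsilon> i))"
    by (rule continuous_on_compose2[of UNIV real]) (auto intro: continuous_on_product_coordinates)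
  then have "continuous_on S (\<lambda>\<epsilon> :: int \<Rightarrow> nat. real (\<epsilon> i))" by (rule continuous_on_subset) simp
  then show ?thesis by (intro continuous_on_mult_right)
qed

text \<open>The two series of \<open>\<delta>\<close> are the majorants in the Weierstrass test;
  this is where domination by one sequence enters.\<close>

lemma continuous_on_planar:
  assumes d: "\<delta> \<in> Xtilde M"
  shows "continuous_on {\<epsilon>. \<forall>n. \<epsilon> n \<le> \<delta> n} (planar t)"
proof -
  let ?D = "{\<epsilon>. \<forall>n. \<epsilon> n \<le> \<delta> n}"
  have "continuous_on ?D future"
  proof (rule uniform_limit_theorem[OF _ Weierstrass_m_test, of _ "\<lambda>n \<epsilon>. real (\<epsilon> (int n)) / \<Lambda> ^ n",
        folded future_def, OF _ _ summable_future[OF d]])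
    show "\<forall>\<^sub>F n in sequentially. continuous_on ?D (\<lambda>\<epsilon>. \<Sum>i<n. real (\<epsilon> (int i)) / \<Lambda> ^ i)"
      unfolding divide_inverse by (intro always_eventually allI continuous_on_sum continuous_on_digit)
  qed (auto intro!: divide_right_mono)
  moreover have "continuous_on ?D past"
  proof (rule uniform_limit_theorem[OF _ Weierstrass_m_test, of _ "\<lambda>k \<epsilon>. real (\<epsilon> (- int (Suc k))) * \<mu> ^ Suc k",
        folded past_def, OF _ _ conjunct2[OF d[unfolded Xtilde_alt]]])
    show "\<forall>\<^sub>F n in sequentially. continuous_on ?D (\<lambda>\<epsilon>. \<Sum>i<n. real (\<epsilon> (- int (Suc i))) * \<mu> ^ Suc i)"
      by (intro always_eventually allI continuous_on_sum continuous_on_digit)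
  qed (auto simp: abs_mult power_abs simp del: power_Suc of_nat_Suc intro!: mult_right_mono)
  ultimately show ?thesis unfolding planar_def[abs_def] by (intro continuous_intros)
qed

lemma shift_in_Xtilde: "\<epsilon> \<in> Xtilde M \<Longrightarrow> shift \<epsilon> \<in> Xtilde M"
proof -
  assume e: "\<epsilon> \<in> Xtilde M"
  have "summable (\<lambda>n. \<Lambda> * (real (\<epsilon> (int (Suc n))) / \<Lambda> ^ Suc n))"
    by (rule summable_mult) (use summable_future[OF e] in \<open>simp only: summable_Suc_iff[of "\<lambda>n. real (\<epsilon> (int n)) / \<Lambda> ^ n"]\<close>)
  moreover have "summable (\<lambda>k. real (shift \<epsilon> (- int (Suc (Suc k)))) * \<bar>\<mu>\<bar> ^ Suc (Suc k))"
  proof -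
    have "summable (\<lambda>k. \<bar>\<mu>\<bar> * (real (\<epsilon> (- int (Suc k))) * \<bar>\<mu>\<bar> ^ Suc k))"
      by (rule summable_mult) (use e in \<open>simp add: Xtilde_alt\<close>)
    then show ?thesis by (simp add: shift_def mult_ac)
  qed
  ultimately show ?thesis
    unfolding Xtilde_alt summable_Suc_iff[of "\<lambda>k. real (shift \<epsilon> (- int (Suc k))) * \<bar>\<mu>\<bar> ^ Suc k", symmetric]
    by (simp add: shift_def add.commute)
qed

lemma coding_map_phi:
  assumes t: "t \<in> homoclinic_coords M"
  shows "coding_map M (phi M t)"
  unfolding coding_map_def
proof (intro conjI ballI)
  show "phi M t \<in> extensional (Xtilde M)" by (simp add: phi_def)
next
  fix \<delta> assume d: "\<delta> \<in> Xtilde M"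
  have "continuous_on {\<epsilon>. \<forall>n. \<epsilon> n \<le> \<delta> n} (\<lambda>\<epsilon>. to_torus (planar t \<epsilon>))"
    by (rule continuous_on_compose2[OF continuous_on_to_torus[of UNIV] continuous_on_planar[OF d]]) simp
  then show "continuous_on {\<epsilon>. \<forall>n. \<epsilon> n \<le> \<delta> n} (phi M t)"
    by (rule continuous_on_eq) (use phi_limits(3)[OF t] dominated_in_Xtilde[OF d] in auto)
next
  fix \<epsilon> \<epsilon>' assume e: "\<epsilon> \<in> Xtilde M" "\<epsilon>' \<in> Xtilde M"
  have "future (\<lambda>n. \<epsilon> n + \<epsilon>' n) = future \<epsilon> + future \<epsilon>'"
    unfolding future_def of_nat_add add_divide_distrib
    by (rule suminf_add[symmetric]) (intro summable_future e)+
  moreover have "past (\<lambda>n. \<epsilon> n + \<epsilon>' n) = past \<epsilon> + past \<epsilon>'"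
    unfolding past_def of_nat_add distrib_right
    by (rule suminf_add[symmetric]) (intro summable_past e)+
  ultimately have "planar t (\<lambda>n. \<epsilon> n + \<epsilon>' n) = planar t \<epsilon> + planar t \<epsilon>'"
    by (simp add: planar_def scaleR_add_left)
  then show "phi M t (\<lambda>n. \<epsilon> n + \<epsilon>' n) = phi M t \<epsilon> + phi M t \<epsilon>'"
    by (simp add: phi_limits(3)[OF t] e Xtilde_add to_torus_add)
next
  fix \<epsilon> assume e: "\<epsilon> \<in> Xtilde M"
  have "to_torus (planar t (shift \<epsilon>)) = to_torus (A *v planar t \<epsilon>)"
    using planar_shift[OF t e] unfolding to_torus_eq_lattice[symmetric] by simp
  then show "phi M t (shift \<epsilon>) = torus_aut M (phi M t \<epsilon>)"
    by (simp add: phi_limits(3)[OF t] e shift_in_Xtilde torus_aut_to_torus)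
qed

text \<open>For sequences vanishing to the left, the sum stays on the expanding line and the coding
  becomes an ordinary expansion in base \<open>\<Lambda>\<close>. Place \<open>-K\<close> has weight
  \<open>\<Lambda> ^ K\<close> while the first term of \<open>x\<close> has weight
  \<open>1 / \<Lambda>\<close>, hence the exponent \<open>Suc K\<close>.\<close>

lemma phi_left_finite:
  assumes t: "t \<in> homoclinic_coords M" and e: "\<epsilon> \<in> Xtilde M"
    and left: "\<And>n. n < - int K \<Longrightarrow> \<epsilon> n = 0"
    and x: "(\<lambda>i. real (tail \<epsilon> (- int K) i) / \<Lambda> ^ Suc i) sums x"
  shows "phi M t \<epsilon> = to_torus ((x * \<Lambda> ^ Suc K) *\<^sub>R t)"
proof (rule LIMSEQ_unique)
  show "(\<lambda>N. to_torus (\<Sum>n = - int N..int N. real (\<epsilon> n) *\<^sub>R iter ((*v) A) (- n) t)) \<longlonglongrightarrow> phi M t \<epsilon>"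
    using phi_limits(2,3)[OF t e] by simp
  have "(\<lambda>N. \<Sum>i<N + Suc K. real (tail \<epsilon> (- int K) i) / \<Lambda> ^ Suc i) \<longlonglongrightarrow> x"
    using x unfolding sums_def by (rule LIMSEQ_ignore_initial_segment)
  then have "(\<lambda>N. to_torus (((\<Sum>i<N + Suc K. real (tail \<epsilon> (- int K) i) / \<Lambda> ^ Suc i) * \<Lambda> ^ Suc K) *\<^sub>R t))
      \<longlonglongrightarrow> to_torus ((x * \<Lambda> ^ Suc K) *\<^sub>R t)"
    by (intro tendsto_to_torus tendsto_intros)
  then show "(\<lambda>N. to_torus (\<Sum>n = - int N..int N. real (\<epsilon> n) *\<^sub>R iter ((*v) A) (- n) t))
      \<longlonglongrightarrow> to_torus ((x * \<Lambda> ^ Suc K) *\<^sub>R t)"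
  proof (rule Lim_transform_eventually)
    show "\<forall>\<^sub>F N in sequentially.
      to_torus (((\<Sum>i<N + Suc K. real (tail \<epsilon> (- int K) i) / \<Lambda> ^ Suc i) * \<Lambda> ^ Suc K) *\<^sub>R t)
      = to_torus (\<Sum>n = - int N..int N. real (\<epsilon> n) *\<^sub>R iter ((*v) A) (- n) t)"
      using eventually_ge_at_top[of K]
    proof eventually_elim
      case (elim N)
      have "(\<Sum>n = - int N..int N. real (\<epsilon> n) * \<Lambda> powi (- n))
          = (\<Sum>n = - int K..int N. real (\<epsilon> n) * \<Lambda> powi (- n))"
        using elim left by (intro sum.mono_neutral_right) auto
      also have "\<dots> = (\<Sum>i<N + Suc K. real (\<epsilon> (- int K + int i)) * \<Lambda> powi (- (- int K + int i)))"
        by (rule sum.reindex_bij_witness[of _ "\<lambda>i. - int K + int i" "\<lambda>n. nat (n + int K)"]) auto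
      also have "\<dots> = (\<Sum>i<N + Suc K. real (tail \<epsilon> (- int K) i) / \<Lambda> ^ Suc i * \<Lambda> ^ Suc K)"
        by (intro sum.cong refl)
          (simp add: tail_def power_int_diff[of \<Lambda> "int K", simplified])
      finally show ?case
        by (simp add: iter_eigen[OF homoclinic_eigen[OF t]] scaleR_sum_left[symmetric] sum_distrib_right
            del: sum.lessThan_Suc power_Suc)
    qed
  qed
qed

section \<open>Every coding map comes from a homoclinic point\<close>

lemma unit_seq_in_Xtilde: "unit_seq m \<in> Xtilde M"
  by (rule bounded_in_Xtilde[of _ 1]) (simp add: unit_seq_def)

lemma phi_unit_seq:
  assumes t: "t \<in> homoclinic_coords M"
  shows "phi M t (unit_seq 0) = to_torus t"
proof -
  have "(\<lambda>i. real (tail (unit_seq 0) (- int 0) i) / \<Lambda> ^ Suc i) sums (\<Sum>i\<in>{0}. real (tail (unit_seq 0) (- int 0) i) / \<Lambda> ^ Suc i)"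
    by (rule sums_finite) (auto simp: tail_def unit_seq_def)
  from phi_left_finite[OF t unit_seq_in_Xtilde _ this] show ?thesis
    by (simp add: tail_def unit_seq_def)
qed

lemma coding_map_zero:
  assumes "coding_map M \<phi>"
  shows "\<phi> (\<lambda>_. 0) = 0"
proof -
  have "(\<lambda>_. 0) \<in> Xtilde M" by (rule bounded_in_Xtilde[of _ 0]) simp
  then have "\<phi> (\<lambda>n. 0 + 0) = \<phi> (\<lambda>_. 0) + \<phi> (\<lambda>_. 0)"
    using assms unfolding coding_map_def by fastforce
  then show ?thesis by simp
qed

lemma coding_map_unit_seq:
  assumes "coding_map M \<phi>"
  shows "\<phi> (unit_seq (- k)) = iter (torus_aut M) k (\<phi> (unit_seq 0))"
proof -
  have step: "\<phi> (unit_seq (- (k + 1))) = torus_aut M (\<phi> (unit_seq (- k)))" for k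
    using assms unit_seq_in_Xtilde shift_unit_seq[of "- (k + 1)"] unfolding coding_map_def
    by (metis add.commute add_minus_cancel minus_add_distrib)
  show ?thesis
  proof (induction k rule: int_induct[where k = 0])
    case base
    then show ?case by (simp add: iter_def)
  next
    case (step1 i)
    then show ?case using step[of i] iter_Suc[OF bij_torus_aut] by simp
  next
    case (step2 i)
    have "torus_aut M (\<phi> (unit_seq (- (i - 1)))) = torus_aut M (iter (torus_aut M) (i - 1) (\<phi> (unit_seq 0)))"
      using step[of "i - 1"] iter_Suc[OF bij_torus_aut, of "i - 1" "\<phi> (unit_seq 0)"] step2 by simp
    then show ?case using bij_torus_aut by (simp add: bij_def inj_eq)
  qed
qed

text \<open>Unit sequences whose position escapes to infinity tend to zero coordinatewise inside the
  box of 0-1 sequences, where continuity is available. By equivariance their images form the orbit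
  of \<open>\<phi> (unit_seq 0)\<close>.\<close>

lemma coding_map_homoclinic:
  assumes c: "coding_map M \<phi>"
  shows "homoclinic M (\<phi> (unit_seq 0))"
proof -
  let ?D = "{\<epsilon> :: int \<Rightarrow> nat. \<forall>n. \<epsilon> n \<le> 1}"
  have "(\<lambda>_. 1) \<in> Xtilde M" by (rule bounded_in_Xtilde[of _ 1]) simp
  moreover have "\<forall>\<delta>\<in>Xtilde M. continuous_on {\<epsilon>. \<forall>n. \<epsilon> n \<le> \<delta> n} \<phi>"
    using c unfolding coding_map_def by blast
  ultimately have cont: "continuous_on ?D \<phi>" by fastforce
  have lim: "(\<lambda>n. \<phi> (unit_seq (f n))) \<longlonglongrightarrow> 0" if f: "\<And>i. \<forall>\<^sub>F n in sequentially. f n \<noteq> i" for f :: "nat \<Rightarrow> int"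
  proof -
    have "(\<lambda>n. unit_seq (f n)) \<longlonglongrightarrow> (\<lambda>_. 0)"
    proof (rule tendsto_fun_eventually_eq)
      show "\<forall>\<^sub>F n in sequentially. unit_seq (f n) i = 0" for i
        using f[of i] by eventually_elim (simp add: unit_seq_def)
    qed
    from continuous_on_tendsto_compose[OF cont this] have "(\<lambda>n. \<phi> (unit_seq (f n))) \<longlonglongrightarrow> \<phi> (\<lambda>_. 0)"
      by (simp add: unit_seq_def)
    then show ?thesis by (simp add: coding_map_zero[OF c])
  qed
  have "\<forall>\<^sub>F n in sequentially. - int n \<noteq> i" "\<forall>\<^sub>F n in sequentially. - (- int n) \<noteq> i" for i
    by (rule eventually_mono[OF eventually_gt_at_top[of "nat \<bar>i\<bar>"]]; auto)+
  from lim[OF this(1)] lim[OF this(2)]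
  show ?thesis unfolding homoclinic_def coding_map_unit_seq[OF c] by blast
qed

text \<open>Equivariance fixes the values on unit sequences and additivity those on finite
  sequences. The truncations of \<open>\<epsilon>\<close> converge to it within the set dominated by
  \<open>\<epsilon>\<close> itself, so continuity does the rest.\<close>

lemma coding_map_determined:
  assumes c: "coding_map M \<phi>" "coding_map M \<psi>" and eq: "\<phi> (unit_seq 0) = \<psi> (unit_seq 0)"
  shows "\<phi> = \<psi>"
proof -
  have add: "\<theta> (\<lambda>n. \<epsilon> n + \<epsilon>' n) = \<theta> \<epsilon> + \<theta> \<epsilon>'"
    if "coding_map M \<theta>" "\<epsilon> \<in> Xtilde M" "\<epsilon>' \<in> Xtilde M" for \<theta> \<epsilon> \<epsilon>'
    using that unfolding coding_map_def by blast
  have mult: "\<phi> (\<lambda>n. if n = m then a else 0) = \<psi> (\<lambda>n. if n = m then a else 0)" for m a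
  proof (induction a)
    case 0
    then show ?case by (simp add: coding_map_zero c)
  next
    case (Suc a)
    let ?u = "\<lambda>n. if n = m then a else 0"
    have "?u \<in> Xtilde M" by (rule bounded_in_Xtilde[of _ a]) simp
    moreover have "(\<lambda>n. if n = m then Suc a else 0) = (\<lambda>n. ?u n + unit_seq m n)"
      by (auto simp: unit_seq_def)
    moreover have "\<phi> (unit_seq m) = \<psi> (unit_seq m)"
      using coding_map_unit_seq[OF c(1), of "- m"] coding_map_unit_seq[OF c(2), of "- m"] eq by simp
    ultimately show ?case
      using Suc add[OF c(1) _ unit_seq_in_Xtilde, of ?u m] add[OF c(2) _ unit_seq_in_Xtilde, of ?u m]
      by simp
  qed
  have "\<phi> \<epsilon> = \<psi> \<epsilon>" if e: "\<epsilon> \<in> Xtilde M" for \<epsilon>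
  proof (rule LIMSEQ_unique)
    have res: "\<phi> (\<lambda>n. if n \<in> F then \<epsilon> n else 0) = \<psi> (\<lambda>n. if n \<in> F then \<epsilon> n else 0)" if "finite F" for F
      using that
    proof (induction F rule: finite_induct)
      case empty
      then show ?case by (simp add: coding_map_zero c)
    next
      case (insert m F)
      let ?u = "\<lambda>n. if n \<in> F then \<epsilon> n else 0" and ?v = "\<lambda>n. if n = m then \<epsilon> m else 0"
      have "?u \<in> Xtilde M" by (rule dominated_in_Xtilde[OF e]) simp
      moreover have "?v \<in> Xtilde M" by (rule dominated_in_Xtilde[OF e]) simp
      moreover have "(\<lambda>n. if n \<in> insert m F then \<epsilon> n else 0) = (\<lambda>n. ?u n + ?v n)"
        using insert.hyps by auto
      ultimately show ?case
        using insert.IH mult[of m "\<epsilon> m"] add[OF c(1), of ?u ?v] add[OF c(2), of ?u ?v] by simp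
    qed
    have tr: "truncate K \<epsilon> = (\<lambda>n. if n \<in> {- int K..int K} then \<epsilon> n else 0)" for K
      by (rule ext) (auto simp: truncate_def)
    have lim: "(\<lambda>K. \<theta> (truncate K \<epsilon>)) \<longlonglongrightarrow> \<theta> \<epsilon>" if "coding_map M \<theta>" for \<theta>
    proof (rule continuous_on_tendsto_compose[OF _ truncate_tendsto])
      show "continuous_on {\<epsilon>'. \<forall>n. \<epsilon>' n \<le> \<epsilon> n} \<theta>" using that e unfolding coding_map_def by blast
    qed (auto simp: truncate_le)
    show "(\<lambda>K. \<phi> (truncate K \<epsilon>)) \<longlonglongrightarrow> \<phi> \<epsilon>" by (rule lim[OF c(1)])
    show "(\<lambda>K. \<phi> (truncate K \<epsilon>)) \<longlonglongrightarrow> \<psi> \<epsilon>"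
      using lim[OF c(2)] res[of "{- int K..int K}" for K] unfolding tr by simp
  qed
  then show ?thesis using c unfolding coding_map_def by (blast intro: extensionalityI)
qed

lemma coding_map_eq_phi:
  assumes "coding_map M \<phi>"
  obtains t where "t \<in> homoclinic_coords M" "\<phi> = phi M t"
proof -
  have "\<phi> (unit_seq 0) \<in> to_torus ` homoclinic_coords M"
    using coding_map_homoclinic[OF assms] bij_betw_homoclinic_coords by (auto simp: bij_betw_def)
  then obtain t where t: "t \<in> homoclinic_coords M" "\<phi> (unit_seq 0) = to_torus t" by blast
  then show ?thesis
    using that coding_map_determined[OF assms coding_map_phi] phi_unit_seq by metis
qed

text \<open>Evaluation at \<open>unit_seq 0\<close> recovers the homoclinic point, and hence its
  lift.\<close>

lemma bij_betw_phi: "bij_betw (phi M) (homoclinic_coords M) {\<phi>. coding_map M \<phi>}"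
  unfolding bij_betw_def
proof
  show "inj_on (phi M) (homoclinic_coords M)"
  proof (rule inj_onI)
    fix t t' assume t: "t \<in> homoclinic_coords M" "t' \<in> homoclinic_coords M" "phi M t = phi M t'"
    then have "to_torus t = to_torus t'" using phi_unit_seq by metis
    then show "t = t'" using t bij_betw_homoclinic_coords by (auto simp: bij_betw_def inj_on_def)
  qed
  show "phi M ` homoclinic_coords M = {\<phi>. coding_map M \<phi>}"
    using coding_map_phi coding_map_eq_phi by blast
qed

end


subsection \<open>The compactum of admissible sequences\<close>

lemma abs_suminf_tail_le:
  fixes d :: "nat \<Rightarrow> real"
  assumes q: "0 \<le> q" "q < 1" and zero: "\<And>n. n < N \<Longrightarrow> d n = 0" and le: "\<And>n. \<bar>d n\<bar> \<le> b * q ^ n"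
  shows "\<bar>\<Sum>n. d n\<bar> \<le> b / (1 - q) * q ^ N"
proof -
  have geo: "(\<lambda>n. b * q ^ N * q ^ n) sums (b * q ^ N * (1 / (1 - q)))"
    using q by (intro sums_mult geometric_sums) auto
  have le': "norm (d (n + N)) \<le> b * q ^ N * q ^ n" for n
    using le[of "n + N"] by (simp add: power_add mult_ac)
  have "summable (\<lambda>n. b * q ^ n)" using q by (intro summable_mult summable_geometric) simp
  moreover have "norm (d n) \<le> b * q ^ n" if "n \<ge> 0" for n using le[of n] by simp
  ultimately have "summable d" by (rule summable_comparison_test')
  then have "(\<Sum>n. d n) = (\<Sum>n. d (n + N))" using zero by (simp add: suminf_split_initial_segment[of d N])
  also have "\<bar>\<dots>\<bar> \<le> b * q ^ N * (1 / (1 - q))"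
    using norm_suminf_le[OF le' sums_summable[OF geo]] sums_unique[OF geo] by simp
  finally show ?thesis by (simp add: mult_ac)
qed

locale hyperbolic_coding = hyperbolic_matrix M + quasi_greedy "lam M" w
  for M :: "int^2^2" and w :: "nat \<Rightarrow> nat"
begin

lemma shift_space_Xtilde: "shift_space \<subseteq> Xtilde M"
  using bounded_in_Xtilde[of _ "w 0"] shift_space_le by blast

lemma shift_image_shift_space: "shift ` shift_space = shift_space"
proof (intro equalityI subsetI)
  have tl: "tail (shift \<epsilon>) n = tail \<epsilon> (n + 1)" for \<epsilon> n
    by (simp add: tail_def shift_def fun_eq_iff add_ac)
  show "\<epsilon> \<in> shift_space" if "\<epsilon> \<in> shift ` shift_space" for \<epsilon>
    using that tl by (auto simp: shift_space_def)
  show "\<epsilon> \<in> shift ` shift_space" if "\<epsilon> \<in> shift_space" for \<epsilon>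
  proof
    show "\<epsilon> = shift (\<lambda>n. \<epsilon> (n - 1))" by (simp add: shift_def)
    have "tail (\<lambda>n. \<epsilon> (n - 1)) n = tail \<epsilon> (n - 1)" for n
      by (simp add: tail_def fun_eq_iff algebra_simps)
    then show "(\<lambda>n. \<epsilon> (n - 1)) \<in> shift_space" using that by (auto simp: shift_space_def)
  qed
qed

text \<open>A violation is a place at which some tail first exceeds \<open>w\<close>, and this is
  visible in finitely many coordinates.\<close>

lemma closed_shift_space: "closed shift_space"
proof -
  have "- shift_space = (\<Union>N. \<Union>n. {\<epsilon>. \<forall>i\<in>{..n}. \<epsilon> (N + int i) \<in> (if i < n then {w i} else {w n<..})})"
  proof (intro equalityI subsetI)
    fix \<epsilon> assume "\<epsilon> \<in> - shift_space"
    then obtain N n where "\<forall>i<n. w i = \<epsilon> (N + int i)" "w n < \<epsilon> (N + int n)"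
      unfolding shift_space_def by (auto simp: not_lex_le lex_less_def tail_def)
    then show "\<epsilon> \<in> (\<Union>N. \<Union>n. {\<epsilon>. \<forall>i\<in>{..n}. \<epsilon> (N + int i) \<in> (if i < n then {w i} else {w n<..})})"
      by (intro UN_I[of N] UN_I[of n]) (auto simp: not_less dest!: le_antisym)
  next
    fix \<epsilon> assume "\<epsilon> \<in> (\<Union>N. \<Union>n. {\<epsilon>. \<forall>i\<in>{..n}. \<epsilon> (N + int i) \<in> (if i < n then {w i} else {w n<..})})"
    then obtain N n where *: "\<And>i. i \<le> n \<Longrightarrow> \<epsilon> (N + int i) \<in> (if i < n then {w i} else {w n<..})"
      by auto
    have "lex_less w (tail \<epsilon> N)"
      unfolding lex_less_def tail_def
    proof (intro exI conjI allI impI)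
      show "w i = \<epsilon> (N + int i)" if "i < n" for i using *[of i] that by simp
      show "w n < \<epsilon> (N + int n)" using *[of n] by simp
    qed
    then show "\<epsilon> \<in> - shift_space" by (auto simp: shift_space_def simp flip: not_lex_le)
  qed
  also have "open \<dots>"
    by (intro open_UN ballI product_topology_basis') (auto intro: open_discrete)
  finally show ?thesis by (simp add: closed_def)
qed

lemma compact_shift_space: "compact shift_space"
proof -
  have "compactin (product_topology (\<lambda>_. euclidean) UNIV) (PiE (UNIV :: int set) (\<lambda>_. {..w 0}))"
    by (simp add: compactin_PiE finite_imp_compact)
  then have "compact (PiE (UNIV :: int set) (\<lambda>_. {..w 0}))"
    by (simp add: euclidean_product_topology)
  then have "compact (PiE (UNIV :: int set) (\<lambda>_. {..w 0}) \<inter> shift_space)"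
    by (intro compact_Int_closed closed_shift_space)
  moreover have "PiE (UNIV :: int set) (\<lambda>_. {..w 0}) \<inter> shift_space = shift_space"
    using shift_space_le by (auto simp: PiE_UNIV_domain)
  ultimately show ?thesis by simp
qed

lemma lex_total_shift_space: "lex_total M shift_space"
  unfolding lex_total_def
proof (intro ballI allI impI)
  fix \<epsilon> \<epsilon>' N assume e: "\<epsilon> \<in> shift_space" and le: "\<forall>k. lex_le (tail \<epsilon>' (N + k)) (tail \<epsilon> N)"
  have "lex_le (tail \<epsilon>' n) w" for n
    using le[rule_format, of "n - N"] e lex_le_trans by (auto simp: shift_space_def)
  then show "\<epsilon>' \<in> shift_space" by (simp add: shift_space_def)
qed

text \<open>Scaled below 1, \<open>x\<close> has an admissible expansion, whose first digit is put
  at place \<open>-n\<close>. The zeros to its left keep the sequence in the compactum because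
  \<open>w 0\<close> is positive.\<close>

lemma half_line_in_image:
  assumes t: "t \<in> homoclinic_coords M" and x: "0 \<le> x"
  shows "to_torus (x *\<^sub>R t) \<in> phi M t ` shift_space"
proof -
  obtain n where "x < \<Lambda> ^ n" using real_arch_pow[OF lam_gt_1] by blast
  also have "\<Lambda> ^ n \<le> \<Lambda> ^ Suc n" using lam_gt_1 by (intro power_increasing) auto
  finally have n: "x < \<Lambda> ^ Suc n" .
  then have "0 \<le> x / \<Lambda> ^ Suc n" "x / \<Lambda> ^ Suc n < 1"
    using x by (auto simp del: power_Suc)
  from expansion_exists[OF this] obtain a where a: "admissible a"
    "(\<lambda>i. real (a i) / \<Lambda> ^ Suc i) sums (x / \<Lambda> ^ Suc n)" by blast
  define \<epsilon> where "\<epsilon> k = (if k < - int n then 0 else a (nat (k + int n)))" for k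
  have tail: "tail \<epsilon> (- int n + int k) = (\<lambda>i. a (k + i))" for k
    by (auto simp: tail_def \<epsilon>_def fun_eq_iff nat_add_distrib)
  have "lex_le (tail \<epsilon> k) w" for k
  proof (cases "k < - int n")
    case True
    then have "lex_less (tail \<epsilon> k) w" using w0_pos
      unfolding lex_less_def by (intro exI[of _ 0]) (simp add: tail_def \<epsilon>_def)
    then show ?thesis by (simp add: lex_le_def)
  next
    case False
    then have "k = - int n + int (nat (k + int n))" by simp
    then show ?thesis using tail a(1) unfolding admissible_def by metis
  qed
  then have e: "\<epsilon> \<in> shift_space" by (simp add: shift_space_def)
  have "phi M t \<epsilon> = to_torus ((x / \<Lambda> ^ Suc n * \<Lambda> ^ Suc n) *\<^sub>R t)"
  proof (rule phi_left_finite[OF t])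
    show "\<epsilon> \<in> Xtilde M" using e shift_space_Xtilde by blast
    show "(\<lambda>i. real (tail \<epsilon> (- int n) i) / \<Lambda> ^ Suc i) sums (x / \<Lambda> ^ Suc n)"
      using a(2) tail[of 0] by simp
  qed (simp add: \<epsilon>_def)
  then show ?thesis using e by (intro image_eqI[of _ _ \<epsilon>]) auto
qed

text \<open>A vertical or rational direction would put a nonzero lattice vector on the expanding
  eigenline.\<close>

lemma eigenline_slope:
  assumes t: "A *v t = \<Lambda> *\<^sub>R t" "t \<noteq> 0"
  shows "t $ 1 \<noteq> 0" "t $ 2 / t $ 1 \<notin> \<rat>"
proof -
  have no: "c *\<^sub>R t \<notin> lattice" if "c \<noteq> 0" for c
    using eigen_lattice_zero[of "c *\<^sub>R t"] t that by (auto simp: matrix_vector_mult_scaleR)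
  show t1: "t $ 1 \<noteq> 0"
  proof
    assume "t $ 1 = 0"
    then have "t $ 2 \<noteq> 0" using t(2) by (auto simp: vec_eq_iff forall_2)
    then show False using no[of "1 / t $ 2"] \<open>t $ 1 = 0\<close> by (simp add: lattice_def forall_2)
  qed
  show "t $ 2 / t $ 1 \<notin> \<rat>"
  proof
    assume "t $ 2 / t $ 1 \<in> \<rat>"
    then obtain a b where ab: "b \<noteq> 0" "t $ 2 / t $ 1 = of_int a / of_int b"
      by (metis Rats_cases' less_irrefl)
    then have "(of_int b / t $ 1) * t $ 2 = of_int a" using t1 by (simp add: field_simps)
    then have "(of_int b / t $ 1) *\<^sub>R t \<in> lattice" using t1 by (simp add: lattice_def forall_2)
    then show False using no ab t1 by simp
  qed
qed

text \<open>Kronecker approximation on a vertical line: \<open>x\<close> is chosen so that the first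
  coordinates agree exactly modulo the integer \<open>j\<close>. The second coordinate then moves by
  multiples of the irrational slope.\<close>

lemma half_line_dense:
  assumes t: "A *v t = \<Lambda> *\<^sub>R t" "t \<noteq> 0" and "0 < e"
  obtains x p where "0 \<le> x" "p \<in> lattice" "norm (v - x *\<^sub>R t + p) < e"
proof -
  note slope = eigenline_slope[OF t]
  \<comment> \<open>Density of fractional parts supplies a positive multiple \<open>k\<close>. The
    sign of \<open>t $ 1\<close> and the offset \<open>K\<close>, which is at least
    \<open>\<bar>v $ 1\<bar>\<close>, turn this into \<open>0 \<le> x\<close>.\<close>
  define \<sigma> :: int where "\<sigma> = (if t $ 1 > 0 then 1 else -1)"
  have \<sigma>: "of_int \<sigma> * t $ 1 = \<bar>t $ 1\<bar>" "of_int \<sigma> * of_int \<sigma> = (1::real)" by (auto simp: \<sigma>_def)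
  define \<theta> where "\<theta> = t $ 2 / t $ 1"
  define K where "K = \<lceil>\<bar>v $ 1\<bar>\<rceil>"
  have "of_int \<sigma> * \<theta> \<notin> \<rat>" using slope(2) by (auto simp: \<sigma>_def \<theta>_def)
  from sequence_of_fractional_parts_is_dense[OF this \<open>0 < e\<close>, of "v $ 2 - v $ 1 * \<theta> - of_int \<sigma> * of_int K * \<theta>"]
  obtain h k where k: "k > 0" and
    hk: "\<bar>of_int k * (of_int \<sigma> * \<theta>) - of_int h - (v $ 2 - v $ 1 * \<theta> - of_int \<sigma> * of_int K * \<theta>)\<bar> < e"
    by blast
  define j where "j = \<sigma> * (k + K)"
  define x where "x = (v $ 1 + of_int j) / t $ 1"
  define p :: "real^2" where "p = vector [of_int j, of_int h]"
  show ?thesis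
  proof (rule that)
    have "x = of_int \<sigma> * (v $ 1 + of_int j) / (of_int \<sigma> * t $ 1)"
      by (simp add: x_def \<sigma>_def)
    also have "\<dots> = (of_int \<sigma> * v $ 1 + of_int K + of_int k) / \<bar>t $ 1\<bar>"
      unfolding \<sigma>(1) by (simp add: j_def \<sigma>_def)
    also have "\<dots> \<ge> 0"
    proof -
      have "\<bar>v $ 1\<bar> \<le> of_int K" by (simp add: K_def)
      then have "0 \<le> of_int \<sigma> * v $ 1 + of_int K" by (auto simp: \<sigma>_def)
      then show ?thesis using k by simp
    qed
    finally show "0 \<le> x" .
    show "p \<in> lattice" by (simp add: p_def lattice_def forall_2)
    have "x * t $ 1 = v $ 1 + of_int j" using slope(1) by (simp add: x_def)
    moreover have "x * t $ 2 = (v $ 1 + of_int j) * \<theta>" by (simp add: x_def \<theta>_def)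
    ultimately have "v - x *\<^sub>R t + p = vector [0, v $ 2 - (v $ 1 + of_int j) * \<theta> + of_int h]"
      by (simp add: vec_eq_iff forall_2 p_def)
    then have "norm (v - x *\<^sub>R t + p) = \<bar>v $ 2 - (v $ 1 + of_int j) * \<theta> + of_int h\<bar>"
      by (simp add: norm_vec_def L2_set_def sum_2)
    also have "\<dots> = \<bar>of_int k * (of_int \<sigma> * \<theta>) - of_int h - (v $ 2 - v $ 1 * \<theta> - of_int \<sigma> * of_int K * \<theta>)\<bar>"
      by (subst abs_minus_cancel[symmetric]) (simp add: j_def algebra_simps)
    finally show "norm (v - x *\<^sub>R t + p) < e" using hk by simp
  qed
qed

lemma phi_surjective:
  assumes t: "t \<in> homoclinic_coords M" "t \<noteq> 0"
  shows "phi M t ` shift_space = UNIV"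
proof (rule ccontr)
  let ?I = "phi M t ` shift_space"
  assume "?I \<noteq> UNIV"
  then obtain v where v: "to_torus v \<notin> ?I" using to_torus_surj by (metis UNIV_eq_I)
  \<comment> \<open>Coding maps are continuous on dominated sets; the constant sequence
    \<open>w 0\<close> dominates the whole compactum.\<close>
  have "(\<lambda>_. w 0) \<in> Xtilde M" by (rule bounded_in_Xtilde[of _ "w 0"]) simp
  moreover have "\<forall>\<delta>\<in>Xtilde M. continuous_on {\<epsilon>. \<forall>n. \<epsilon> n \<le> \<delta> n} (phi M t)"
    using coding_map_phi[OF t(1)] by (simp add: coding_map_def)
  ultimately have "continuous_on {\<epsilon>. \<forall>n. \<epsilon> n \<le> w 0} (phi M t)" by fastforce
  then have "continuous_on shift_space (phi M t)"
    by (rule continuous_on_subset) (use shift_space_le in auto)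
  then have "closed ?I" by (intro compact_imp_closed compact_continuous_image compact_shift_space)
  then have "open (to_torus -` (- ?I))" by (simp add: open_Compl flip: open_torus2_def)
  then obtain e where e: "0 < e" "ball v e \<subseteq> to_torus -` (- ?I)"
    using v by (meson ComplI openE vimageI2)
  obtain x p where x: "0 \<le> x" "p \<in> lattice" "norm (v - x *\<^sub>R t + p) < e"
    using half_line_dense[OF homoclinic_eigen[OF t(1)] t(2) e(1)] by blast
  have "x *\<^sub>R t - p \<in> ball v e" using x(3) by (simp add: dist_norm algebra_simps)
  then have "to_torus (x *\<^sub>R t - p) \<notin> ?I" using e(2) by blast
  moreover have "to_torus (x *\<^sub>R t - p) = to_torus (x *\<^sub>R t)"
    using x(2) by (simp add: to_torus_eq_lattice lattice_def)
  ultimately show False using half_line_in_image[OF t(1) x(1)] by simp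
qed

text \<open>Equal images differ in the plane by a lattice vector on the eigenline, hence not at all.
  The real expansions over a common window then coincide, and \<open>partial_inj\<close> compares
  their digits.\<close>

lemma phi_inj_finite:
  assumes t: "t \<in> homoclinic_coords M" "t \<noteq> 0"
  shows "inj_on (phi M t) (shift_space \<inter> finite_seqs)"
proof (rule inj_onI)
  fix \<epsilon> \<epsilon>' assume e: "\<epsilon> \<in> shift_space \<inter> finite_seqs" "\<epsilon>' \<in> shift_space \<inter> finite_seqs"
    and eq: "phi M t \<epsilon> = phi M t \<epsilon>'"
  obtain K1 K2 where K12: "\<And>n. int K1 < \<bar>n\<bar> \<Longrightarrow> \<epsilon> n = 0" "\<And>n. int K2 < \<bar>n\<bar> \<Longrightarrow> \<epsilon>' n = 0"
    using finite_seqs_bound e by (metis IntE)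
  define K where "K = max K1 K2"
  define S where "S \<epsilon> = (\<Sum>i<2 * K + 1. real (tail \<epsilon> (- int K) i) / \<Lambda> ^ Suc i)" for \<epsilon>
  have K: "\<epsilon> n = 0" "\<epsilon>' n = 0" if "int K < \<bar>n\<bar>" for n using that K12 by (auto simp: K_def)
  have val: "phi M t \<epsilon> = to_torus ((S \<epsilon> * \<Lambda> ^ Suc K) *\<^sub>R t)"
    if "\<epsilon> \<in> shift_space" "\<And>n. int K < \<bar>n\<bar> \<Longrightarrow> \<epsilon> n = 0" for \<epsilon>
  proof (rule phi_left_finite[OF t(1)])
    show "\<epsilon> \<in> Xtilde M" using that(1) shift_space_Xtilde by blast
    show "\<epsilon> n = 0" if "n < - int K" for n using that \<open>\<And>n. int K < \<bar>n\<bar> \<Longrightarrow> \<epsilon> n = 0\<close> by simp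
    show "(\<lambda>i. real (tail \<epsilon> (- int K) i) / \<Lambda> ^ Suc i) sums S \<epsilon>"
      unfolding S_def by (rule sums_finite) (auto simp: tail_def that(2))
  qed
  have "to_torus ((S \<epsilon> * \<Lambda> ^ Suc K) *\<^sub>R t) = to_torus ((S \<epsilon>' * \<Lambda> ^ Suc K) *\<^sub>R t)"
    using eq val[of \<epsilon>] val[of \<epsilon>'] e K by simp
  then have "((S \<epsilon> - S \<epsilon>') * \<Lambda> ^ Suc K) *\<^sub>R t \<in> lattice"
    by (simp add: to_torus_eq_lattice algebra_simps)
  moreover have "A *v (((S \<epsilon> - S \<epsilon>') * \<Lambda> ^ Suc K) *\<^sub>R t) = \<Lambda> *\<^sub>R (((S \<epsilon> - S \<epsilon>') * \<Lambda> ^ Suc K) *\<^sub>R t)"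
    by (simp add: matrix_vector_mult_scaleR homoclinic_eigen[OF t(1)])
  ultimately have "S \<epsilon> = S \<epsilon>'" using eigen_lattice_zero t(2) by fastforce
  then have inj: "tail \<epsilon> (- int K) j = tail \<epsilon>' (- int K) j" if "j < 2 * K + 1" for j
    unfolding S_def using partial_inj that e shift_space_iff by blast
  show "\<epsilon> = \<epsilon>'"
  proof
    fix n
    show "\<epsilon> n = \<epsilon>' n"
    proof (cases "int K < \<bar>n\<bar>")
      case False
      then have "nat (n + int K) < 2 * K + 1" "- int K + int (nat (n + int K)) = n" by auto
      then show ?thesis using inj[of "nat (n + int K)"] by (simp add: tail_def)
    qed (simp add: K)
  qed
qed

lemma arithmetic_coding_shift_space:
  assumes "t \<in> homoclinic_coords M" "t \<noteq> 0"
  shows "arithmetic_coding M (phi M t) shift_space"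
  unfolding arithmetic_coding_def
proof (intro conjI)
  have "shift_space = Xtilde M \<inter> shift_space" using shift_space_Xtilde by blast
  then show "closedin (top_of_set (Xtilde M)) shift_space"
    using closedin_closed_Int[OF closed_shift_space, of "Xtilde M"] by simp
qed (use assms coding_map_phi shift_space_Xtilde shift_image_shift_space lex_total_shift_space
    phi_surjective phi_inj_finite in auto)

section \<open>Uniqueness of the compactum by counting words\<close>

lemma planar_close:
  assumes e: "\<epsilon> \<in> shift_space" "\<epsilon>' \<in> shift_space"
    and agree: "\<And>n. \<bar>n\<bar> \<le> int N \<Longrightarrow> \<epsilon> n = \<epsilon>' n"
  shows "\<bar>planar t \<epsilon> $ i - planar t \<epsilon>' $ i\<bar>
    \<le> real (w 0) / (1 - 1 / \<Lambda>) * (norm t + norm (stable t)) * (1 / \<Lambda>) ^ N"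
proof -
  let ?D = "real (w 0) / (1 - 1 / \<Lambda>) * (1 / \<Lambda>) ^ N"
  have X: "\<epsilon> \<in> Xtilde M" "\<epsilon>' \<in> Xtilde M" using e shift_space_Xtilde by auto
  have q: "0 \<le> 1 / \<Lambda>" "1 / \<Lambda> < 1" using lam_gt_1 by auto
  have diff: "\<bar>real (\<epsilon> n) - real (\<epsilon>' n)\<bar> \<le> real (w 0)" for n
    using shift_space_le[OF e(1), of n] shift_space_le[OF e(2), of n] by linarith
  have "future \<epsilon> - future \<epsilon>' = (\<Sum>n. real (\<epsilon> (int n)) / \<Lambda> ^ n - real (\<epsilon>' (int n)) / \<Lambda> ^ n)"
    unfolding future_def by (intro suminf_diff summable_future X)
  also have "\<bar>\<dots>\<bar> \<le> ?D"
  proof (rule abs_suminf_tail_le[OF q])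
    show "\<bar>real (\<epsilon> (int n)) / \<Lambda> ^ n - real (\<epsilon>' (int n)) / \<Lambda> ^ n\<bar> \<le> real (w 0) * (1 / \<Lambda>) ^ n" for n
      unfolding diff_divide_distrib[symmetric]
      using diff[of "int n"] by (simp add: abs_divide power_one_over divide_right_mono)
  qed (simp add: agree)
  finally have fut: "\<bar>future \<epsilon> - future \<epsilon>'\<bar> \<le> ?D" .
  \<comment> \<open>As \<open>\<mu>\<close> has modulus \<open>1 / \<Lambda>\<close>, the past
    contributes a geometric tail of the same ratio as the future.\<close>
  have "past \<epsilon> - past \<epsilon>' = (\<Sum>k. real (\<epsilon> (- int (Suc k))) * \<mu> ^ Suc k - real (\<epsilon>' (- int (Suc k))) * \<mu> ^ Suc k)"
    unfolding past_def by (intro suminf_diff summable_past X)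
  also have "\<bar>\<dots>\<bar> \<le> ?D"
  proof (rule abs_suminf_tail_le[OF q])
    fix k
    have "\<bar>real (\<epsilon> (- int (Suc k))) * \<mu> ^ Suc k - real (\<epsilon>' (- int (Suc k))) * \<mu> ^ Suc k\<bar>
        = \<bar>real (\<epsilon> (- int (Suc k))) - real (\<epsilon>' (- int (Suc k)))\<bar> * (1 / \<Lambda>) ^ Suc k"
      unfolding left_diff_distrib[symmetric] abs_mult power_abs abs_mu ..
    also have "\<dots> \<le> real (w 0) * (1 / \<Lambda>) ^ k"
      using diff lam_gt_1 by (intro mult_mono power_decreasing) auto
    finally show "\<bar>real (\<epsilon> (- int (Suc k))) * \<mu> ^ Suc k - real (\<epsilon>' (- int (Suc k))) * \<mu> ^ Suc k\<bar>
        \<le> real (w 0) * (1 / \<Lambda>) ^ k" .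
  qed (simp add: agree)
  finally have past: "\<bar>past \<epsilon> - past \<epsilon>'\<bar> \<le> ?D" .
  have "planar t \<epsilon> $ i - planar t \<epsilon>' $ i
      = (future \<epsilon> - future \<epsilon>') * t $ i + (past \<epsilon> - past \<epsilon>') * stable t $ i"
    by (simp add: planar_def algebra_simps)
  also have "\<bar>\<dots>\<bar> \<le> ?D * norm t + ?D * norm (stable t)"
    by (rule order.trans[OF abs_triangle_ineq], unfold abs_mult, intro add_mono mult_mono)
      (use fut past component_le_norm_cart in \<open>auto intro: order.trans[OF abs_ge_zero]\<close>)
  finally have "\<bar>planar t \<epsilon> $ i - planar t \<epsilon>' $ i\<bar> \<le> ?D * (norm t + norm (stable t))"
    unfolding distrib_left .
  then show ?thesis by (simp only: mult_ac)
qed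

text \<open>Cylinders over \<open>[-N, N]\<close> map to sets of diameter of order \<open>\<Lambda>\<^sup>-\<^sup>N\<close>, so separating the
  points of a square grid of that mesh takes of the order of \<open>\<Lambda>\<^sup>2\<^sup>N\<close> words.\<close>

lemma grid_le_words:
  assumes t: "t \<in> homoclinic_coords M" and S: "S \<subseteq> shift_space" "phi M t ` S = UNIV"
    and C: "real (w 0) / (1 - 1 / \<Lambda>) * (norm t + norm (stable t)) \<le> C"
    and Q: "real Q * C < \<Lambda> ^ N"
  shows "Q\<^sup>2 \<le> card (words S (2 * N + 1))"
proof -
  define g :: "nat \<times> nat \<Rightarrow> real^2" where "g ij = vector [real (fst ij) / real Q, real (snd ij) / real Q]" for ij
  have "\<exists>\<epsilon>\<in>S. phi M t \<epsilon> = to_torus (g ij)" for ij using S(2) by (metis UNIV_I imageE)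
  then obtain e where e: "\<And>ij. e ij \<in> S" "\<And>ij. phi M t (e ij) = to_torus (g ij)" by metis
  define f where "f ij = map (tail (e ij) (- int N)) [0..<2 * N + 1]" for ij
  \<comment> \<open>Multiplied by \<open>Q\<close>, the hypotheses make
    \<open>i - i' - Q * k\<close> an integer of absolute value below 1. The indices agree modulo
    \<open>Q\<close>, hence agree.\<close>
  have close: "real i / real Q - real i' / real Q - (c - c') \<in> \<int> \<Longrightarrow> \<bar>c - c'\<bar> \<le> C * (1 / \<Lambda>) ^ N
      \<Longrightarrow> i < Q \<Longrightarrow> i' < Q \<Longrightarrow> i = i'" for i i' c c'
  proof -
    assume *: "real i / real Q - real i' / real Q - (c - c') \<in> \<int>" "\<bar>c - c'\<bar> \<le> C * (1 / \<Lambda>) ^ N"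
      "i < Q" "i' < Q"
    from *(1) obtain k :: int where k: "real i / real Q - real i' / real Q - (c - c') = of_int k"
      by (auto elim: Ints_cases)
    have "real Q > 0" using *(3) by simp
    then have "real i - real i' - real Q * of_int k = real Q * (c - c')"
      using k by (simp add: field_simps)
    then have "\<bar>real_of_int (int i - int i' - int Q * k)\<bar> = real Q * \<bar>c - c'\<bar>"
      by (simp add: abs_mult)
    also have "\<dots> \<le> real Q * (C * (1 / \<Lambda>) ^ N)" using *(2) by (intro mult_left_mono) auto
    also have "\<dots> < 1" using Q by (simp add: power_one_over)
    finally have "\<bar>int i - int i' - int Q * k\<bar> < 1" by (simp only: of_int_abs[symmetric] of_int_less_1_iff)
    then have "int i - int i' = int Q * k" by simp
    then have "int i mod int Q = int i' mod int Q" unfolding mod_eq_dvd_iff by simp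
    then show "i = i'" using *(3,4) by simp
  qed
  have "inj_on f ({..<Q} \<times> {..<Q})"
  proof (rule inj_onI)
    fix ij ij' assume ij: "ij \<in> {..<Q} \<times> {..<Q}" "ij' \<in> {..<Q} \<times> {..<Q}" and eq: "f ij = f ij'"
    have agree: "e ij n = e ij' n" if "\<bar>n\<bar> \<le> int N" for n
    proof -
      have "nat (n + int N) \<in> set [0..<2 * N + 1]" using that by auto
      then have "tail (e ij) (- int N) (nat (n + int N)) = tail (e ij') (- int N) (nat (n + int N))"
        using eq unfolding f_def map_eq_conv by blast
      moreover have "0 \<le> n + int N" using that by linarith
      ultimately show ?thesis by (simp add: tail_def)
    qed
    have lat: "g ij - planar t (e ij) \<in> lattice" for ij
      using e phi_limits(3)[OF t] S(1) shift_space_Xtilde by (metis subsetD to_torus_eq_lattice)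
    have "g ij - g ij' - (planar t (e ij) - planar t (e ij')) \<in> lattice"
      using lattice_diff[OF lat[of ij] lat[of ij']] by (simp add: algebra_simps)
    moreover have "\<bar>planar t (e ij) $ i - planar t (e ij') $ i\<bar> \<le> C * (1 / \<Lambda>) ^ N" for i
    proof (rule order.trans[OF planar_close[OF _ _ agree]])
      show "e ij \<in> shift_space" "e ij' \<in> shift_space" using e(1) S(1) by blast+
      show "real (w 0) / (1 - 1 / \<Lambda>) * (norm t + norm (stable t)) * (1 / \<Lambda>) ^ N \<le> C * (1 / \<Lambda>) ^ N"
        by (intro mult_right_mono C) simp
    qed
    ultimately have "fst ij = fst ij'" "snd ij = snd ij'"
      using ij close[of "fst ij" "fst ij'" "planar t (e ij) $ 1" "planar t (e ij') $ 1"]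
        close[of "snd ij" "snd ij'" "planar t (e ij) $ 2" "planar t (e ij') $ 2"]
      by (auto simp: lattice_def forall_2 g_def)
    then show "ij = ij'" by (simp add: prod_eq_iff)
  qed
  moreover have "f ` ({..<Q} \<times> {..<Q}) \<subseteq> words S (2 * N + 1)"
    using e(1) by (auto simp: f_def words_def)
  ultimately have "card ({..<Q} \<times> {..<Q}) \<le> card (words S (2 * N + 1))"
    using finite_words[OF S(1)] by (rule card_inj_on_le)
  then show ?thesis by (simp add: power2_eq_square)
qed

lemma all_prefixes_occur:
  assumes t: "t \<in> homoclinic_coords M" and S: "S \<subseteq> shift_space" "phi M t ` S = UNIV"
  shows "\<exists>\<epsilon>\<in>S. \<exists>N. \<forall>i\<le>m. tail \<epsilon> N i = w i"
proof (rule ccontr)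
  assume "\<not> ?thesis"
  then have "summable (\<lambda>n. real (card (words S n)) / \<Lambda> ^ n)"
    by (intro summable_words[OF S(1), of m]) blast
  then have lim: "(\<lambda>n. real (card (words S n)) / \<Lambda> ^ n) \<longlonglongrightarrow> 0" by (rule summable_LIMSEQ_zero)
  \<comment> \<open>The summand 1 keeps \<open>C\<close> positive. The constant \<open>c\<close>
    below is the value of
    \<open>(\<Lambda> ^ N / (4 * C))\<^sup>2 / \<Lambda> ^ (2 * N + 1)\<close>, the lower bound on
    the density of words that the grid will force.\<close>
  define C where "C = real (w 0) / (1 - 1 / \<Lambda>) * (norm t + norm (stable t)) + 1"
  have "C > 0" using lam_gt_1 by (auto simp: C_def intro!: add_nonneg_pos mult_nonneg_nonneg divide_nonneg_nonneg)
  define c where "c = 1 / (16 * C\<^sup>2 * \<Lambda>)"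
  have "c > 0" using \<open>C > 0\<close> by (simp add: c_def)
  have "\<forall>\<^sub>F N in sequentially. real (card (words S (2 * N + 1))) / \<Lambda> ^ (2 * N + 1) < c"
  proof -
    have "filterlim (\<lambda>N::nat. 2 * N + 1) sequentially sequentially"
      by (rule filterlim_subseq) (simp add: strict_mono_def)
    from filterlim_compose[OF lim this] show ?thesis using \<open>c > 0\<close> by (rule order_tendstoD)
  qed
  moreover have "\<forall>\<^sub>F N in sequentially. 4 * C < \<Lambda> ^ N"
  proof -
    obtain n where n: "4 * C < \<Lambda> ^ n" using real_arch_pow[OF lam_gt_1] by blast
    show ?thesis
      using eventually_ge_at_top[of n]
    proof eventually_elim
      case (elim N)
      show ?case using n power_increasing[OF elim, of \<Lambda>] lam_gt_1 by linarith
    qed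
  qed
  ultimately have "\<forall>\<^sub>F N in sequentially. False"
  proof eventually_elim
    case (elim N)
    \<comment> \<open>The factor 2 gives the strict bound \<open>Q * C < \<Lambda> ^ N\<close>.
      Rounding down still leaves \<open>Q\<close> at least \<open>\<Lambda> ^ N / (4 * C)\<close>
      once \<open>\<Lambda> ^ N\<close> exceeds \<open>4 * C\<close>.\<close>
    define Q where "Q = nat \<lfloor>\<Lambda> ^ N / (2 * C)\<rfloor>"
    have "\<Lambda> ^ N / (2 * C) > 0" using \<open>C > 0\<close> by simp
    then have Q: "real Q \<le> \<Lambda> ^ N / (2 * C)" "\<Lambda> ^ N / (2 * C) < real Q + 1"
      unfolding Q_def by linarith+
    have "real Q * C \<le> \<Lambda> ^ N / 2" using Q(1) \<open>C > 0\<close> by (simp add: field_simps)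
    then have "real Q * C < \<Lambda> ^ N" using zero_less_power[of \<Lambda> N] lam_pos(1) by linarith
    then have "Q\<^sup>2 \<le> card (words S (2 * N + 1))"
      by (intro grid_le_words[OF t S, of C]) (simp_all add: C_def)
    then have card: "(real Q)\<^sup>2 \<le> real (card (words S (2 * N + 1)))"
      by (metis of_nat_le_iff of_nat_power)
    have "1 < \<Lambda> ^ N / (4 * C)" using elim(2) \<open>C > 0\<close> by (simp add: field_simps)
    moreover have "\<Lambda> ^ N / (2 * C) = 2 * (\<Lambda> ^ N / (4 * C))" by simp
    ultimately have "\<Lambda> ^ N / (4 * C) \<le> real Q" using Q(2) by linarith
    then have "(\<Lambda> ^ N / (4 * C))\<^sup>2 \<le> (real Q)\<^sup>2" using \<open>C > 0\<close> by (intro power_mono) auto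
    from order.trans[OF this card]
    have "(\<Lambda> ^ N / (4 * C))\<^sup>2 / \<Lambda> ^ (2 * N + 1) \<le> real (card (words S (2 * N + 1))) / \<Lambda> ^ (2 * N + 1)"
      by (rule divide_right_mono) simp
    moreover have "(\<Lambda> ^ N / (4 * C))\<^sup>2 / \<Lambda> ^ (2 * N + 1) = c"
    proof -
      have "\<Lambda> ^ (2 * N + 1) = \<Lambda> ^ N * \<Lambda> ^ N * \<Lambda>" by (simp add: mult_2 power_add)
      then show ?thesis by (simp only: c_def power2_eq_square) (simp add: field_simps)
    qed
    ultimately show False using elim(1) by simp
  qed
  then show False by simp
qed

lemma shift_space_unique:
  assumes t: "t \<in> homoclinic_coords M" and S: "S \<subseteq> shift_space"
    and coding: "arithmetic_coding M (phi M t) S"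
  shows "S = shift_space"
proof
  have total: "lex_total M S" and surj: "phi M t ` S = UNIV"
    and clos: "closedin (top_of_set (Xtilde M)) S"
    using coding by (simp_all add: arithmetic_coding_def)
  have fin: "y \<in> S" if y: "y \<in> shift_space" "y \<in> finite_seqs" for y
  proof -
    obtain m where m: "\<And>a n. (\<And>i. i \<le> m \<Longrightarrow> a i = w i) \<Longrightarrow> lex_le (tail y n) a"
      using tails_below_prefix[OF y] by blast
    obtain \<epsilon> N where e: "\<epsilon> \<in> S" "\<forall>i\<le>m. tail \<epsilon> N i = w i"
      using all_prefixes_occur[OF t S surj] by blast
    \<comment> \<open>Totality compares one tail of \<open>\<epsilon>\<close> with the tails of
      \<open>y\<close> at all integers, which is why \<open>m\<close> was found uniformly in
      \<open>n\<close>.\<close>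
    then have "\<forall>k. lex_le (tail y (N + k)) (tail \<epsilon> N)" using m by blast
    then show ?thesis using total e(1) y(1) shift_space_Xtilde unfolding lex_total_def by blast
  qed
  obtain T where T: "closed T" "S = Xtilde M \<inter> T" using clos by (auto simp: closedin_closed)
  show "shift_space \<subseteq> S"
  proof
    fix y assume y: "y \<in> shift_space"
    have "truncate K y \<in> T" for K
      using fin[OF shift_space_mono[OF y] truncate_finite] truncate_le T(2) by blast
    then have "y \<in> T" using closed_sequentially[OF T(1) _ truncate_tendsto] by blast
    then show "y \<in> S" using y shift_space_Xtilde T(2) by blast
  qed
qed (rule S)

end


subsection \<open>Relations and the two determinants\<close>

text \<open>\<open>\<rho> n\<close> is what remains of 1 after \<open>n\<close> digits, rescaled by
  \<open>\<beta> ^ n\<close>. Exhibiting a bounded sequence of remainders certifies the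
  expansion.\<close>

lemma sums_one_by_remainders:
  fixes \<beta> :: real
  assumes "1 < \<beta>" "\<rho> 0 = 1" "\<And>n. \<rho> (Suc n) = \<beta> * \<rho> n - real (w n)" "\<And>n. \<bar>\<rho> n\<bar> \<le> 1"
  shows "(\<lambda>i. real (w i) / \<beta> ^ Suc i) sums 1"
proof -
  have partial: "(\<Sum>i<n. real (w i) / \<beta> ^ Suc i) = 1 - \<rho> n * (1 / \<beta>) ^ n" for n
  proof (induction n)
    case (Suc n)
    have "\<rho> (Suc n) * (1 / \<beta>) ^ Suc n = \<rho> n * (1 / \<beta>) ^ n - real (w n) / \<beta> ^ Suc n"
      using assms(1) by (simp add: assms(3) field_simps power_one_over)
    then show ?case using Suc by simp
  qed (simp add: assms(2))
  have "(\<lambda>n. \<rho> n * (1 / \<beta>) ^ n) \<longlonglongrightarrow> 0"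
  proof (rule Lim_null_comparison)
    show "\<forall>\<^sub>F n in sequentially. norm (\<rho> n * (1 / \<beta>) ^ n) \<le> (1 / \<beta>) ^ n"
    proof (intro always_eventually allI)
      fix n
      have "\<bar>\<rho> n\<bar> * (1 / \<beta>) ^ n \<le> 1 * (1 / \<beta>) ^ n"
        using assms(1,4) by (intro mult_right_mono) auto
      then show "norm (\<rho> n * (1 / \<beta>) ^ n) \<le> (1 / \<beta>) ^ n"
        using assms(1) by (simp add: abs_mult)
    qed
    show "(\<lambda>n. (1 / \<beta>) ^ n) \<longlonglongrightarrow> 0" using assms(1) by (intro LIMSEQ_power_zero) simp
  qed
  from tendsto_diff[OF tendsto_const this, of 1] show ?thesis unfolding sums_def partial by simp
qed

section \<open>Finite digit words and the relations between their values\<close>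

definition zero_extend :: "nat list \<Rightarrow> nat \<Rightarrow> nat" where
  "zero_extend xs i = (if i < length xs then xs ! i else 0)"

definition list_seq :: "nat list \<Rightarrow> int \<Rightarrow> nat" where
  "list_seq xs n = (if n < 0 then 0 else zero_extend xs (nat n))"

text \<open>Only suffixes are compared here; a tail of \<open>list_seq xs\<close> that starts left
  of 0 begins with a zero, and for it \<open>0 < a 0\<close> suffices.\<close>

definition dominated :: "nat list \<Rightarrow> (nat \<Rightarrow> nat) \<Rightarrow> bool" where
  "dominated xs a \<longleftrightarrow> (\<forall>k. lex_le (zero_extend (drop k xs)) a)"

lemma lex_le_head_less: "b 0 < a 0 \<Longrightarrow> lex_le b a"
  unfolding lex_le_def lex_less_def by (intro disjI1 exI[of _ 0]) simp

lemma lex_le_single: "x \<le> a 0 \<Longrightarrow> lex_le (zero_extend [x]) a"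
  by (rule lex_le_if_le) (auto simp: zero_extend_def)

lemma dominated_Nil: "dominated [] a"
  unfolding dominated_def by (auto intro!: lex_le_if_le simp: zero_extend_def)

lemma dominated_Cons: "lex_le (zero_extend (x # xs)) a \<Longrightarrow> dominated xs a \<Longrightarrow> dominated (x # xs) a"
  unfolding dominated_def by (metis drop_0 drop_Suc_Cons not0_implies_Suc)

lemma dominated_Cons_less: "x < a 0 \<Longrightarrow> dominated xs a \<Longrightarrow> dominated (x # xs) a"
  by (rule dominated_Cons) (auto intro: lex_le_head_less simp: zero_extend_def)

lemma dominated_replicate: "c < a 0 \<Longrightarrow> dominated xs a \<Longrightarrow> dominated (replicate j c @ xs) a"
  by (induction j) (auto intro: dominated_Cons_less)

lemma dominated_single: "x \<le> a 0 \<Longrightarrow> dominated [x] a"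
  by (intro dominated_Cons dominated_Nil lex_le_single)

lemma dominated_tail:
  assumes "dominated xs a" "0 < a 0"
  shows "lex_le (tail (list_seq xs) k) a"
proof (cases "k < 0")
  case True
  then show ?thesis using assms(2) by (intro lex_le_head_less) (simp add: tail_def list_seq_def)
next
  case False
  then have "tail (list_seq xs) k = zero_extend (drop (nat k) xs)"
    by (auto simp: fun_eq_iff tail_def list_seq_def zero_extend_def nat_add_distrib)
  then show ?thesis using assms(1) by (simp add: dominated_def)
qed

lemma list_seq_finite: "list_seq xs \<in> finite_seqs"
proof -
  have "{n. list_seq xs n \<noteq> 0} \<subseteq> {0..int (length xs)}"
    by (auto simp: list_seq_def zero_extend_def split: if_splits)
  then show ?thesis unfolding finite_seqs_def using finite_subset by blast
qed

context hyperbolic_matrix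
begin

text \<open>Horner form of the expansion. The head has weight \<open>1 / \<Lambda>\<close> here but
  sits at place 0 in \<open>list_seq\<close>, whence the factor \<open>\<Lambda>\<close> in
  \<open>phi_list_seq\<close>.\<close>

primrec list_value :: "nat list \<Rightarrow> real" where
  "list_value [] = 0"
| "list_value (x # xs) = (real x + list_value xs) / \<Lambda>"

lemma list_seq_Xtilde: "list_seq xs \<in> Xtilde M"
proof (rule bounded_in_Xtilde)
  show "list_seq xs n \<le> Max (insert 0 (set xs))" for n
    by (auto simp: list_seq_def zero_extend_def intro: Max_ge)
qed

lemma phi_list_seq:
  assumes t: "t \<in> homoclinic_coords M"
  shows "phi M t (list_seq xs) = to_torus ((list_value xs * \<Lambda>) *\<^sub>R t)"
proof -
  have "list_value xs = (\<Sum>i<length xs. real (zero_extend xs i) / \<Lambda> ^ Suc i)"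
  proof (induction xs)
    case (Cons x xs)
    have "(\<Sum>i<length (x # xs). real (zero_extend (x # xs) i) / \<Lambda> ^ Suc i)
        = real x / \<Lambda> + (\<Sum>i<length xs. real (zero_extend xs i) / \<Lambda> ^ Suc (Suc i))"
      unfolding length_Cons sum.lessThan_Suc_shift by (simp add: zero_extend_def)
    also have "(\<Sum>i<length xs. real (zero_extend xs i) / \<Lambda> ^ Suc (Suc i)) = list_value xs / \<Lambda>"
      unfolding Cons.IH sum_divide_distrib by (simp add: mult_ac)
    finally show ?case by (simp add: add_divide_distrib)
  qed simp
  moreover have "(\<lambda>i. real (zero_extend xs i) / \<Lambda> ^ Suc i) sums (\<Sum>i<length xs. real (zero_extend xs i) / \<Lambda> ^ Suc i)"
    by (rule sums_finite) (auto simp: zero_extend_def)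
  moreover have "tail (list_seq xs) (- int 0) = zero_extend xs"
    by (simp add: tail_def list_seq_def fun_eq_iff)
  ultimately show ?thesis
    using phi_left_finite[OF t list_seq_Xtilde, of 0 xs] by (simp add: list_seq_def)
qed

text \<open>Totality forces both sides of the relation into the coding, against injectivity on finite
  sequences.\<close>

lemma coding_no_relation:
  assumes t: "t \<in> homoclinic_coords M" and coding: "arithmetic_coding M (phi M t) S"
    and e: "\<epsilon> \<in> S" "0 < tail \<epsilon> N 0"
    and dom: "dominated xs (tail \<epsilon> N)" "dominated ys (tail \<epsilon> N)"
    and eq: "list_value xs = list_value ys" and neq: "list_seq xs 0 \<noteq> list_seq ys 0"
  shows False
proof -
  have total: "lex_total M S" and inj: "inj_on (phi M t) (S \<inter> finite_seqs)"
    using coding by (simp_all add: arithmetic_coding_def)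
  have "list_seq zs \<in> S" if "dominated zs (tail \<epsilon> N)" for zs
    using total e(1) dominated_tail[OF that e(2)] list_seq_Xtilde unfolding lex_total_def by blast
  then have "list_seq xs = list_seq ys"
    using dom phi_list_seq[OF t] eq list_seq_finite by (intro inj_onD[OF inj]) auto
  then show False using neq by simp
qed

definition r :: nat where "r = nat (trace M)"

lemma trace_r: "trace M = int r"
  using trace_pos by (simp add: r_def)

lemma lam_sq_r: "\<Lambda> * \<Lambda> = real r * \<Lambda> - of_int (det M)"
  using lam_sq by (simp add: trace_r)

text \<open>The greedy expansion of 1 is the finite \<open>r, 1\<close>; lowering its last digit by
  one and repeating gives the infinite one.\<close>

definition wX :: "nat \<Rightarrow> nat" where "wX i = (if even i then r else 0)"

text \<open>After the first digit the remainder is \<open>1 - 1 / \<Lambda>\<close>, which the digit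
  \<open>r - 2\<close> reproduces.\<close>

definition wY :: "nat \<Rightarrow> nat" where "wY i = (if i = 0 then r - 1 else r - 2)"

text \<open>At a violation the tail is at least \<open>r, 1, 0, 0, ...\<close>. It then dominates
  both \<open>[0, r, 1]\<close> and \<open>[1]\<close>, the two sides of
  \<open>\<Lambda>\<^sup>2 = r \<Lambda> + 1\<close> aligned at their leading place.\<close>

lemma coding_subset_X_comp:
  assumes d: "det M = -1" and t: "t \<in> homoclinic_coords M" and coding: "arithmetic_coding M (phi M t) S"
  shows "S \<subseteq> X_comp M"
proof
  fix \<epsilon> assume e: "\<epsilon> \<in> S"
  have r: "r \<ge> 1" using trace_pos by (simp add: r_def)
  have rL: "real r = \<Lambda> - 1 / \<Lambda>" using lam_sq_r d by (simp add: field_simps)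
  show "\<epsilon> \<in> X_comp M"
  proof (rule ccontr)
    assume "\<epsilon> \<notin> X_comp M"
    then have "\<exists>n. r < \<epsilon> n \<or> r = \<epsilon> n \<and> 1 \<le> \<epsilon> (n + 1)"
      unfolding X_comp_def trace_r mem_Collect_eq of_nat_le_iff of_nat_eq_iff by (metis less_one not_le)
    then obtain n where n: "r < \<epsilon> n \<or> r = \<epsilon> n \<and> 1 \<le> \<epsilon> (n + 1)" ..
    let ?a = "tail \<epsilon> n"
    have a: "r < ?a 0 \<or> r = ?a 0 \<and> 1 \<le> ?a 1" using n by (simp add: tail_def)
    have "lex_le (zero_extend [r, 1]) ?a"
      using a
    proof
      assume *: "r = ?a 0 \<and> 1 \<le> ?a 1"
      show ?thesis
        by (rule lex_le_if_le) (use * in \<open>auto simp: zero_extend_def less_Suc_eq\<close>)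
    qed (auto intro: lex_le_head_less simp: zero_extend_def)
    then have "dominated [0, r, 1] ?a" using a r
      by (intro dominated_Cons_less[of 0] dominated_Cons[of r] dominated_single) auto
    moreover have "dominated [1] ?a" using a r by (intro dominated_single) auto
    moreover have "list_value [0, r, 1] = list_value [1]"
      by (simp add: rL field_simps)
    ultimately show False
      using coding_no_relation[OF t coding e, of n "[0, r, 1]" "[1]"] a r
      by (auto simp: list_seq_def zero_extend_def)
  qed
qed

lemma Y_comp_iff:
  assumes d: "det M = 1"
  shows "\<epsilon> \<in> Y_comp M \<longleftrightarrow> (\<forall>n. \<epsilon> n \<le> r - 1) \<and>
    \<not> (\<exists>n j. \<epsilon> n = r - 1 \<and> (\<forall>i\<in>{1..j}. \<epsilon> (n + int i) = r - 2) \<and> \<epsilon> (n + int j + 1) = r - 1)"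
proof -
  have r: "r \<ge> 3" using det_cases d by (simp add: r_def)
  have "int (\<epsilon> n) \<le> int r - 1 \<longleftrightarrow> \<epsilon> n \<le> r - 1" "int (\<epsilon> n) = int r - 1 \<longleftrightarrow> \<epsilon> n = r - 1"
    "int (\<epsilon> n) = int r - 2 \<longleftrightarrow> \<epsilon> n = r - 2" for n using r by linarith+
  then show ?thesis by (simp add: Y_comp_def trace_r)
qed

text \<open>The digits \<open>-1, r, -1\<close> have value zero, which deals with a digit of at
  least \<open>r\<close>. Adding this relation at \<open>j + 2\<close> consecutive places gives
  \<open>-1, r - 1, r - 2, ..., r - 2, r - 1, -1\<close>, whose positive part is the forbidden
  block.\<close>

lemma coding_subset_Y_comp:
  assumes d: "det M = 1" and t: "t \<in> homoclinic_coords M" and coding: "arithmetic_coding M (phi M t) S"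
  shows "S \<subseteq> Y_comp M"
proof
  fix \<epsilon> assume e: "\<epsilon> \<in> S"
  have r: "r \<ge> 3" using det_cases d by (simp add: r_def)
  have rL: "real r = \<Lambda> + 1 / \<Lambda>" using lam_sq_r d by (simp add: field_simps)
  show "\<epsilon> \<in> Y_comp M"
  proof (rule ccontr)
    assume "\<epsilon> \<notin> Y_comp M"
    then consider n where "\<not> \<epsilon> n \<le> r - 1"
      | n j where "\<epsilon> n = r - 1" "\<forall>i\<in>{1..j}. \<epsilon> (n + int i) = r - 2" "\<epsilon> (n + int j + 1) = r - 1"
      unfolding Y_comp_iff[OF d] by blast
    then show False
    proof cases
      case (1 n)
      then have a: "r \<le> tail \<epsilon> n 0" by (simp add: tail_def)
      have "dominated [0, r] (tail \<epsilon> n)" using a r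
        by (intro dominated_Cons_less[of 0] dominated_single) auto
      moreover have "dominated [1, 0, 1] (tail \<epsilon> n)" using a r
        by (intro dominated_Cons_less dominated_single) auto
      moreover have "list_value [0, r] = list_value [1, 0, 1]"
        by (simp add: rL field_simps)
      ultimately show False
        using coding_no_relation[OF t coding e, of n "[0, r]" "[1, 0, 1]"] a r
        by (auto simp: list_seq_def zero_extend_def)
    next
      case (2 n j)
      let ?a = "tail \<epsilon> n" and ?block = "replicate j (r - 2) @ [r - 1]"
      have a0: "?a 0 = r - 1" using 2 by (simp add: tail_def)
      have "lex_le (zero_extend ((r - 1) # ?block)) ?a"
      proof (rule lex_le_if_le)
        fix i
        consider "i = 0" | "1 \<le> i" "i \<le> j" | "i = Suc j" | "Suc j < i" by linarith
        then show "zero_extend ((r - 1) # ?block) i \<le> ?a i"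
          using 2 by cases (auto simp: zero_extend_def nth_append tail_def nth_Cons' add_ac)
      qed
      then have "dominated (0 # (r - 1) # ?block) ?a" using a0 r
        by (intro dominated_Cons_less[of 0] dominated_Cons[of "r - 1"] dominated_replicate dominated_single) auto
      moreover have "dominated (1 # replicate (j + 2) 0 @ [1]) ?a" using a0 r
        by (intro dominated_Cons_less dominated_replicate dominated_single) auto
      moreover have "list_value (0 # (r - 1) # ?block) = list_value (1 # replicate (j + 2) 0 @ [1])"
      proof -
        \<comment> \<open>\<open>1 - 1 / \<Lambda>\<close> is the value of the constant expansion
          \<open>r - 2, r - 2, ...\<close> and is fixed by prepending that digit; ending with
          \<open>r - 1\<close> accounts for the extra power.\<close>
        have block: "list_value ?block = 1 - 1 / \<Lambda> + (1 / \<Lambda>) ^ (j + 2)"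
        proof (induction j)
          case 0
          then show ?case using r by (simp add: of_nat_diff rL power2_eq_square field_simps)
        next
          case (Suc j)
          have "list_value (replicate (Suc j) (r - 2) @ [r - 1])
              = (real (r - 2) + (1 - 1 / \<Lambda> + (1 / \<Lambda>) ^ (j + 2))) / \<Lambda>"
            using Suc.IH by simp
          also have "\<dots> = (\<Lambda> - 1) / \<Lambda> + (1 / \<Lambda>) ^ (j + 2) / \<Lambda>"
            using r by (simp add: of_nat_diff rL add_divide_distrib[symmetric] del: power_Suc)
          finally show ?case by (simp add: diff_divide_distrib)
        qed
        have zeros: "list_value (replicate k 0 @ [1]) = (1 / \<Lambda>) ^ (k + 1)" for k
          by (induction k) simp_all
        have "real (r - 1) + (1 - 1 / \<Lambda> + z) = \<Lambda> + z" for z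
          using r by (simp add: of_nat_diff rL)
        then have "list_value (0 # (r - 1) # ?block) = (\<Lambda> + (1 / \<Lambda>) ^ (j + 2)) / \<Lambda> / \<Lambda>"
          unfolding list_value.simps block by simp
        also have "\<dots> = list_value (1 # replicate (j + 2) 0 @ [1])"
          unfolding list_value.simps zeros by (simp add: add_divide_distrib)
        finally show ?thesis .
      qed
      ultimately show False
        using coding_no_relation[OF t coding e, of n "0 # (r - 1) # ?block" "1 # replicate (j + 2) 0 @ [1]"] a0 r
        by (auto simp: list_seq_def zero_extend_def)
    qed
  qed
qed

section \<open>The two compacta as spaces of admissible sequences\<close>

lemma hyperbolic_coding_X:
  assumes d: "det M = -1"
  shows "hyperbolic_coding M wX"
proof -
  have r: "r \<ge> 1" using trace_pos by (simp add: r_def)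
  have "quasi_greedy \<Lambda> wX"
  proof
    show "(\<lambda>i. real (wX i) / \<Lambda> ^ Suc i) sums 1"
    proof (rule sums_one_by_remainders[where \<rho> = "\<lambda>n. if even n then 1 else 1 / \<Lambda>"])
      show "(if even (Suc n) then 1 else 1 / \<Lambda>) = \<Lambda> * (if even n then 1 else 1 / \<Lambda>) - real (wX n)" for n
        using lam_sq_r d by (simp add: wX_def field_simps)
    qed (use lam_gt_1 in auto)
    show "\<exists>i\<ge>n. wX i \<noteq> 0" for n using r by (intro exI[of _ "2 * n"]) (simp add: wX_def)
    show "lex_le (\<lambda>i. wX (k + i)) wX" for k
    proof (cases "even k")
      case True
      then show ?thesis by (intro lex_le_if_le) (simp add: wX_def)
    next
      case False
      then show ?thesis using r by (intro lex_le_head_less) (simp add: wX_def)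
    qed
  qed (rule lam_gt_1)
  then show ?thesis using hyperbolic_matrix_axioms by (simp add: hyperbolic_coding_def)
qed

lemma hyperbolic_coding_Y:
  assumes d: "det M = 1"
  shows "hyperbolic_coding M wY"
proof -
  have r: "r \<ge> 3" using det_cases d by (simp add: r_def)
  have rL: "real r = \<Lambda> + 1 / \<Lambda>" using lam_sq_r d by (simp add: field_simps)
  have "quasi_greedy \<Lambda> wY"
  proof
    show "(\<lambda>i. real (wY i) / \<Lambda> ^ Suc i) sums 1"
    proof (rule sums_one_by_remainders[where \<rho> = "\<lambda>n. if n = 0 then 1 else 1 - 1 / \<Lambda>"])
      show "(if Suc n = 0 then 1 else 1 - 1 / \<Lambda>) = \<Lambda> * (if n = 0 then 1 else 1 - 1 / \<Lambda>) - real (wY n)" for n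
        using r by (simp add: wY_def of_nat_diff rL field_simps)
      show "\<bar>if n = 0 then 1 else 1 - 1 / \<Lambda>\<bar> \<le> 1" for n :: nat
        using lam_gt_1 by (simp add: abs_le_iff field_simps)
    qed (use lam_gt_1 in auto)
    show "\<exists>i\<ge>n. wY i \<noteq> 0" for n using r by (intro exI[of _ n]) (simp add: wY_def)
    show "lex_le (\<lambda>i. wY (k + i)) wY" for k
    proof (cases "k = 0")
      case True
      then show ?thesis by (simp add: lex_le_def)
    next
      case False
      then show ?thesis using r by (intro lex_le_head_less) (simp add: wY_def)
    qed
  qed (rule lam_gt_1)
  then show ?thesis using hyperbolic_matrix_axioms by (simp add: hyperbolic_coding_def)
qed

text \<open>The first excess over \<open>wX\<close> at an even place is a digit above
  \<open>r\<close>; at an odd place it is a nonzero digit right after a digit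
  \<open>r\<close>.\<close>

lemma X_comp_eq:
  assumes d: "det M = -1"
  shows "X_comp M = quasi_greedy.shift_space wX"
proof -
  interpret hyperbolic_coding M wX by (rule hyperbolic_coding_X[OF d])
  show ?thesis
  proof (intro equalityI subsetI)
    fix \<epsilon> assume e: "\<epsilon> \<in> X_comp M"
    have "\<not> lex_less wX (tail \<epsilon> n)" for n
    proof
      assume "lex_less wX (tail \<epsilon> n)"
      then obtain m where m: "\<And>i. i < m \<Longrightarrow> wX i = \<epsilon> (n + int i)" "wX m < \<epsilon> (n + int m)"
        by (auto simp: lex_less_def tail_def)
      show False
      proof (cases "even m")
        case True
        then show False using m(2) e by (auto simp: X_comp_def wX_def trace_r not_le[symmetric])
      next
        case False
        then obtain k where k: "m = Suc k" "even k" by (metis even_Suc not0_implies_Suc even_zero)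
        then have "\<epsilon> (n + int k) = r" using m(1)[of k] by (simp add: wX_def)
        then have "\<epsilon> (n + int k + 1) = 0" using e by (auto simp: X_comp_def trace_r)
        then show False using m(2) k by (simp add: add_ac)
      qed
    qed
    then show "\<epsilon> \<in> shift_space" by (simp add: shift_space_def not_lex_le[symmetric])
  next
    fix \<epsilon> assume e: "\<epsilon> \<in> shift_space"
    have "\<epsilon> n \<le> r" for n using shift_space_le[OF e, of n] by (simp add: wX_def)
    moreover have "\<epsilon> (n + 1) = 0" if "\<epsilon> n = r" for n
    proof (rule ccontr)
      assume "\<epsilon> (n + 1) \<noteq> 0"
      then have "lex_less wX (tail \<epsilon> n)"
        unfolding lex_less_def using that by (intro exI[of _ 1]) (simp add: tail_def wX_def)
      then show False using e by (auto simp: shift_space_def simp flip: not_lex_le)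
    qed
    ultimately show "\<epsilon> \<in> X_comp M" by (simp add: X_comp_def trace_r)
  qed
qed

text \<open>With digits at most \<open>r - 1\<close>, a tail can first exceed \<open>wY\<close> only
  by closing \<open>r - 1, r - 2, ..., r - 2\<close> with another \<open>r - 1\<close>, which is
  exactly a forbidden block.\<close>

lemma Y_comp_eq:
  assumes d: "det M = 1"
  shows "Y_comp M = quasi_greedy.shift_space wY"
proof -
  interpret hyperbolic_coding M wY by (rule hyperbolic_coding_Y[OF d])
  have r: "r \<ge> 3" using det_cases d by (simp add: r_def)
  note Y = Y_comp_iff[OF d]
  show ?thesis
  proof (intro equalityI subsetI)
    fix \<epsilon> assume e: "\<epsilon> \<in> Y_comp M"
    have "\<not> lex_less wY (tail \<epsilon> n)" for n
    proof
      assume "lex_less wY (tail \<epsilon> n)"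
      then obtain m where m: "\<And>i. i < m \<Longrightarrow> wY i = \<epsilon> (n + int i)" "wY m < \<epsilon> (n + int m)"
        by (auto simp: lex_less_def tail_def)
      have le: "\<epsilon> k \<le> r - 1" for k using e by (simp add: Y)
      have "m \<noteq> 0"
      proof
        assume "m = 0"
        then show False using m(2) le[of n] by (simp add: wY_def)
      qed
      then obtain j where j: "m = Suc j" using not0_implies_Suc by blast
      have "\<epsilon> n = r - 1" using m(1)[of 0] j by (simp add: wY_def)
      moreover have "\<forall>i\<in>{1..j}. \<epsilon> (n + int i) = r - 2"
      proof
        fix i assume "i \<in> {1..j}"
        then show "\<epsilon> (n + int i) = r - 2" using m(1)[of i] j by (simp add: wY_def)
      qed
      moreover have "\<epsilon> (n + int j + 1) = r - 1"
        using m(2) le[of "n + int j + 1"] j r by (simp add: wY_def add_ac)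
      ultimately show False using e unfolding Y by blast
    qed
    then show "\<epsilon> \<in> shift_space" by (simp add: shift_space_def not_lex_le[symmetric])
  next
    fix \<epsilon> assume e: "\<epsilon> \<in> shift_space"
    have "\<epsilon> n \<le> r - 1" for n using shift_space_le[OF e, of n] by (simp add: wY_def)
    moreover have False if block: "\<epsilon> n = r - 1" "\<forall>i\<in>{1..j}. \<epsilon> (n + int i) = r - 2" "\<epsilon> (n + int j + 1) = r - 1" for n j
    proof -
      have "lex_less wY (tail \<epsilon> n)"
        unfolding lex_less_def
      proof (intro exI conjI allI impI)
        show "wY i = tail \<epsilon> n i" if "i < Suc j" for i
          using block that by (cases "i = 0") (auto simp: wY_def tail_def)
        show "wY (Suc j) < tail \<epsilon> n (Suc j)" using block(3) r by (simp add: wY_def tail_def add_ac)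
      qed
      then show False using e by (auto simp: shift_space_def simp flip: not_lex_le)
    qed
    ultimately show "\<epsilon> \<in> Y_comp M" unfolding Y by blast
  qed
qed

abbreviation "compactum \<equiv> (if det M = -1 then X_comp M else Y_comp M)"

lemma arithmetic_coding_compactum:
  assumes t: "t \<in> homoclinic_coords M"
  shows "t \<noteq> 0 \<Longrightarrow> arithmetic_coding M (phi M t) compactum"
    and "arithmetic_coding M (phi M t) S \<Longrightarrow> S = compactum"
proof -
  have "(t \<noteq> 0 \<longrightarrow> arithmetic_coding M (phi M t) compactum) \<and>
    (arithmetic_coding M (phi M t) S \<longrightarrow> S = compactum)"
  proof (cases "det M = -1")
    case True
    then interpret X: hyperbolic_coding M wX by (rule hyperbolic_coding_X)
    show ?thesis
      using X.arithmetic_coding_shift_space[OF t] X.shift_space_unique[OF t]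
        coding_subset_X_comp[OF True t] True X_comp_eq[OF True] by auto
  next
    case False
    then have d: "det M = 1" using det_cases by auto
    then interpret Y: hyperbolic_coding M wY by (rule hyperbolic_coding_Y)
    show ?thesis
      using Y.arithmetic_coding_shift_space[OF t] Y.shift_space_unique[OF t]
        coding_subset_Y_comp[OF d t] d Y_comp_eq[OF d] by auto
  qed
  then show "t \<noteq> 0 \<Longrightarrow> arithmetic_coding M (phi M t) compactum"
    "arithmetic_coding M (phi M t) S \<Longrightarrow> S = compactum" by blast+
qed

lemma arithmetic_coding_nonzero:
  assumes t: "t \<in> homoclinic_coords M" and coding: "arithmetic_coding M (phi M t) S"
  shows "t \<noteq> 0"
proof
  assume "t = 0"
  have "iter ((*v) A) (- n) t = 0" for n
    by (subst iter_eigen[OF homoclinic_eigen[OF t]]) (simp add: \<open>t = 0\<close>)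
  then have "phi M t \<epsilon> = 0" if "\<epsilon> \<in> Xtilde M" for \<epsilon>
    using phi_limits(2,3)[OF t that] by (simp add: to_torus_zero LIMSEQ_const_iff)
  moreover have "phi M t ` S = UNIV" "S \<subseteq> Xtilde M"
    using coding by (simp_all add: arithmetic_coding_def)
  ultimately have "to_torus (vector [1 / 2, 0]) = 0" by (metis UNIV_I imageE subsetD)
  then have "(1 / 2 :: real) \<in> \<int>"
    by (simp add: to_torus_zero[symmetric] to_torus_eq_iff forall_2)
  then obtain k where "(1 / 2 :: real) = of_int k" by (rule Ints_cases)
  then have "real_of_int (2 * k) = real_of_int 1" by simp
  then have "2 * k = 1" unfolding of_int_eq_iff .
  then show False by presburger
qed

end

theorem theorem1p2:
  fixes M :: "int^2^2"
  assumes "invertible M" and "hyperbolic M" and "trace M > 0"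
  shows
    "\<comment> \<open>each homoclinic point has exactly one lift on the eigenline\<close>
     bij_betw to_torus (homoclinic_coords M) {x. homoclinic M x} \<and>
     \<comment> \<open>(I), convergence of the limit and of the bilateral series\<close>
     (\<forall>t\<in>homoclinic_coords M. \<forall>\<epsilon>\<in>Xtilde M.
        ((\<lambda>N. to_torus (\<Sum>n = - int N..int N. real (\<epsilon> n) *\<^sub>R iter ((*v) (real_mat M)) (- n) t))
           \<longlonglongrightarrow> phi M t \<epsilon>) \<and>
        ((\<lambda>(K, N). to_torus ((\<Sum>n = - int K..int N. real (\<epsilon> n) * lam M powi (- n)) *\<^sub>R t))
           \<longlongrightarrow> phi M t \<epsilon>) (sequentially \<times>\<^sub>F sequentially)) \<and>
     \<comment> \<open>(I), the correspondence on the level of maps, for all homoclinic points\<close>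
     bij_betw (phi M) (homoclinic_coords M) {\<phi>. coding_map M \<phi>} \<and>
     \<comment> \<open>(I), surjectivity\<close>
     (\<forall>t\<in>homoclinic_coords M. t \<noteq> 0 \<longrightarrow> phi M t ` Xtilde M = UNIV) \<and>
     \<comment> \<open>(I), the correspondence for pairs; the zero map is not surjective on any set\<close>
     bij_betw (\<lambda>t. (phi M t, if det M = -1 then X_comp M else Y_comp M))
       (homoclinic_coords M - {0}) {(\<phi>, X). arithmetic_coding M \<phi> X} \<and>
     \<comment> \<open>(II)\<close>
     (\<forall>\<phi> X. arithmetic_coding M \<phi> X \<longrightarrow>
        (det M = -1 \<longrightarrow> X = X_comp M) \<and> (det M = 1 \<longrightarrow> X = Y_comp M))"
proof -
  interpret hyperbolic_matrix M using assms by unfold_locales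
  have from_phi: "\<exists>t\<in>homoclinic_coords M - {0}. \<phi> = phi M t \<and> X = compactum"
    if "arithmetic_coding M \<phi> X" for \<phi> X
  proof -
    have "coding_map M \<phi>" using that by (simp add: arithmetic_coding_def)
    then obtain t where "t \<in> homoclinic_coords M" "\<phi> = phi M t" by (rule coding_map_eq_phi)
    then show ?thesis
      using that arithmetic_coding_nonzero arithmetic_coding_compactum(2) by blast
  qed
  show ?thesis
  proof (intro conjI ballI impI allI)
    fix t assume t: "t \<in> homoclinic_coords M" "t \<noteq> 0"
    show "phi M t ` Xtilde M = UNIV"
      using arithmetic_coding_compactum(1)[OF t] unfolding arithmetic_coding_def by blast
  next
    have "inj_on (phi M) (homoclinic_coords M)" using bij_betw_phi by (simp add: bij_betw_def)
    then have "inj_on (\<lambda>t. (phi M t, compactum)) (homoclinic_coords M - {0})"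
      by (auto simp: inj_on_def)
    moreover have "(\<lambda>t. (phi M t, compactum)) ` (homoclinic_coords M - {0}) = {(\<phi>, X). arithmetic_coding M \<phi> X}"
      using from_phi arithmetic_coding_compactum(1) by fast
    ultimately show "bij_betw (\<lambda>t. (phi M t, compactum)) (homoclinic_coords M - {0})
        {(\<phi>, X). arithmetic_coding M \<phi> X}"
      by (rule bij_betw_imageI)
  next
    fix \<phi> X assume coding: "arithmetic_coding M \<phi> X"
    show "X = X_comp M" if "det M = -1" using from_phi[OF coding] that by simp
    show "X = Y_comp M" if "det M = 1" using from_phi[OF coding] that by simp
  qed (use phi_limits bij_betw_homoclinic_coords bij_betw_phi in auto)
qed

end
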